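(* Let $\mathbb{K}\in\{\mathbb{R},\mathbb{C}\}$ and let $\mathcal{X}$ be a topological $\mathbb{K}$-vector space whose topological dual $\mathcal{X}^{\ast}$ separates the points of $\mathcal{X}$. (i) If $\mathcal{X}$ is a separable Gateaux-differentiability space and $\mathcal{U}$ is a $0$-neighborhood in $\mathcal{X}$ satisfying the infinite-dimensionality condition, then $\mathcal{D}_{\mathcal{U}}$ is a dense $G_\delta$ subset of $\mathbf{CU}_{\mathcal{U}}(\mathcal{X}^{\ast})$ in the weak*-Hausdorff hypertopology. (ii) If $\mathcal{X}$ is separable and completely metrizable and some $0$-neighborhood in $\mathcal{X}$ satisfies the infinite-dimensionality condition, then $\mathcal{D}$ is a dense $G_\delta$ subset of $\mathbf{CU}(\mathcal{X}^{\ast})$ in the weak*-Hausdorff hypertopology.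
   Context: Topological vector spaces are Hausdorff; $\mathcal{X}^{\ast}$ carries the weak* topology. $\mathcal{X}$ is a Gateaux-differentiability space if every continuous convex real-valued function whose domain is a nonempty open convex subset of $\mathcal{X}$ is Gateaux-differentiable on a dense subset of that domain. A $0$-neighborhood $\mathcal{U}$ satisfies the infinite-dimensionality condition if there is an infinite set $\{\sigma_n\}_{n\in\mathbb{N}}$ of linearly independent elements of $\mathcal{X}^{\ast}$ with $\sup_{A\in\mathcal{U}}|\sigma_n(A)|<\infty$ for every $n$. $\mathcal{U}^{\circ}=\{\sigma\in\mathcal{X}^{\ast}:|\sigma(A)|\le1\ \forall A\in\mathcal{U}\}$; $\mathbf{CU}_{\mathcal{U}}(\mathcal{X}^{\ast})$ is the set of nonempty convex weak*-closed subsets of $\mathcal{U}^{\circ}$ and $\mathbf{CU}(\mathcal{X}^{\ast})=\bigcup_{\mathcal{U}}\mathbf{CU}_{\mathcal{U}}(\mathcal{X}^{\ast})$ over all $0$-neighborhoods. $\mathcal{D}_{\mathcal{U}}=\{U\in\mathbf{CU}_{\mathcal{U}}(\mathcal{X}^{\ast}):U=\overline{\mathcal{E}(U)}\}$ with $\mathcal{E}(U)$ the extreme points and weak*-closure, and $\mathcal{D}=\bigcup_{\mathcal{U}}\mathcal{D}_{\mathcal{U}}$. The weak*-Hausdorff hypertopology is generated by the extended pseudometrics $d_H^{(A)}(F,\tilde F)=\max\{\sup_{\sigma\in F}\inf_{\tilde\sigma\in\tilde F}|(\sigma-\tilde\sigma)(A)|,\ \sup_{\tilde\sigma\in\tilde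 F}\inf_{\sigma\in F}|(\sigma-\tilde\sigma)(A)|\}$, $A\in\mathcal{X}$. *)

theory Defs
  imports "HOL-Analysis.Analysis"
begin

definition tvs :: "('k::real_normed_field \<Rightarrow> 'a::{t2_space,ab_group_add} \<Rightarrow> 'a) \<Rightarrow> bool" where
  "tvs sc \<longleftrightarrow> Vector_Spaces.vector_space sc
     \<and> continuous_on UNIV (\<lambda>(x::'a, y::'a). x + y)
     \<and> continuous_on UNIV (\<lambda>(c::'k, x::'a). sc c x)"

definition tdual :: "('k::real_normed_field \<Rightarrow> 'a::{t2_space,ab_group_add} \<Rightarrow> 'a) \<Rightarrow> ('a \<Rightarrow> 'k) set" where
  "tdual sc = {f. Vector_Spaces.linear sc (*) f \<and> continuous_on UNIV f}"

definition dual_separates_points :: "('k::real_normed_field \<Rightarrow> 'a::{t2_space,ab_group_add} \<Rightarrow> 'a) \<Rightarrow> bool" where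
  "dual_separates_points sc \<longleftrightarrow> (\<forall>x y. x \<noteq> y \<longrightarrow> (\<exists>\<sigma>\<in>tdual sc. \<sigma> x \<noteq> \<sigma> y))"

definition weakstar :: "('k::real_normed_field \<Rightarrow> 'a::{t2_space,ab_group_add} \<Rightarrow> 'a) \<Rightarrow> ('a \<Rightarrow> 'k) topology" where
  "weakstar sc = subtopology (product_topology (\<lambda>_. euclidean) UNIV) (tdual sc)"

definition zero_nhd :: "'a::{topological_space,zero} set \<Rightarrow> bool" where
  "zero_nhd U \<longleftrightarrow> (\<exists>V. open V \<and> 0 \<in> V \<and> V \<subseteq> U)"

definition inf_dim_cond :: "('k::real_normed_field \<Rightarrow> 'a::{t2_space,ab_group_add} \<Rightarrow> 'a) \<Rightarrow> 'a set \<Rightarrow> bool" where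
  "inf_dim_cond sc U \<longleftrightarrow>
     (\<exists>\<sigma>::nat \<Rightarrow> ('a \<Rightarrow> 'k).
        (\<forall>n. \<sigma> n \<in> tdual sc)
      \<and> (\<forall>n (c::nat \<Rightarrow> 'k). (\<forall>x. (\<Sum>i<n. c i * \<sigma> i x) = 0) \<longrightarrow> (\<forall>i<n. c i = 0))
      \<and> (\<forall>n. \<exists>B::real. \<forall>A\<in>U. norm (\<sigma> n A) \<le> B))"

definition polar :: "('k::real_normed_field \<Rightarrow> 'a::{t2_space,ab_group_add} \<Rightarrow> 'a) \<Rightarrow> 'a set \<Rightarrow> ('a \<Rightarrow> 'k) set" where
  "polar sc U = {\<sigma> \<in> tdual sc. \<forall>A\<in>U. norm (\<sigma> A) \<le> 1}"

definition fconvex :: "('a \<Rightarrow> 'k::real_normed_field) set \<Rightarrow> bool" where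
  "fconvex F \<longleftrightarrow> (\<forall>f\<in>F. \<forall>g\<in>F. \<forall>t::real. 0 \<le> t \<and> t \<le> 1 \<longrightarrow>
      (\<lambda>x. of_real t * f x + of_real (1 - t) * g x) \<in> F)"

definition CU_U :: "('k::real_normed_field \<Rightarrow> 'a::{t2_space,ab_group_add} \<Rightarrow> 'a) \<Rightarrow> 'a set \<Rightarrow> ('a \<Rightarrow> 'k) set set" where
  "CU_U sc U = {F. F \<noteq> {} \<and> fconvex F \<and> closedin (weakstar sc) F \<and> F \<subseteq> polar sc U}"

definition CU :: "('k::real_normed_field \<Rightarrow> 'a::{t2_space,ab_group_add} \<Rightarrow> 'a) \<Rightarrow> ('a \<Rightarrow> 'k) set set" where
  "CU sc = (\<Union>U\<in>{U. zero_nhd U}. CU_U sc U)"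

definition extreme_points :: "('a \<Rightarrow> 'k::real_normed_field) set \<Rightarrow> ('a \<Rightarrow> 'k) set" where
  "extreme_points F = {\<sigma>\<in>F. \<forall>f\<in>F. \<forall>g\<in>F. \<forall>t::real. 0 < t \<and> t < 1 \<and>
      \<sigma> = (\<lambda>x. of_real t * f x + of_real (1 - t) * g x) \<longrightarrow> f = g}"

definition D_U :: "('k::real_normed_field \<Rightarrow> 'a::{t2_space,ab_group_add} \<Rightarrow> 'a) \<Rightarrow> 'a set \<Rightarrow> ('a \<Rightarrow> 'k) set set" where
  "D_U sc U = {F \<in> CU_U sc U. F = weakstar sc closure_of extreme_points F}"

definition D :: "('k::real_normed_field \<Rightarrow> 'a::{t2_space,ab_group_add} \<Rightarrow> 'a) \<Rightarrow> ('a \<Rightarrow> 'k) set set" where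
  "D sc = (\<Union>U\<in>{U. zero_nhd U}. D_U sc U)"

definition dH :: "'a \<Rightarrow> ('a \<Rightarrow> 'k::real_normed_field) set \<Rightarrow> ('a \<Rightarrow> 'k) set \<Rightarrow> ereal" where
  "dH A F G = max (SUP \<sigma>\<in>F. INF \<tau>\<in>G. ereal (norm ((\<sigma> - \<tau>) A)))
                  (SUP \<tau>\<in>G. INF \<sigma>\<in>F. ereal (norm ((\<sigma> - \<tau>) A)))"

definition wsH :: "('a \<Rightarrow> 'k::real_normed_field) set topology" where
  "wsH = topology (\<lambda>W. \<forall>F\<in>W. \<exists>As (\<epsilon>::real). finite As \<and> 0 < \<epsilon> \<and>
            {G. \<forall>A\<in>As. dH A F G < ereal \<epsilon>} \<subseteq> W)"

definition dense_gdelta_in :: "'b topology \<Rightarrow> 'b set \<Rightarrow> bool" where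
  "dense_gdelta_in X S \<longleftrightarrow> S \<subseteq> topspace X \<and> X closure_of S = topspace X \<and> gdelta_in X S"

definition gateaux_differentiable_at ::
  "('k::real_normed_field \<Rightarrow> 'a::{t2_space,ab_group_add} \<Rightarrow> 'a) \<Rightarrow> ('a \<Rightarrow> real) \<Rightarrow> 'a \<Rightarrow> bool" where
  "gateaux_differentiable_at sc f x \<longleftrightarrow>
     (\<exists>L::'a \<Rightarrow> real. (\<forall>u v. L (u + v) = L u + L v)
        \<and> (\<forall>c::real. \<forall>u. L (sc (of_real c) u) = c * L u)
        \<and> continuous_on UNIV L
        \<and> (\<forall>h. ((\<lambda>t::real. (f (x + sc (of_real t) h) - f x) / t) \<longlongrightarrow> L h) (at 0)))"

definition set_convex :: "('k::real_normed_field \<Rightarrow> 'a::{t2_space,ab_group_add} \<Rightarrow> 'a) \<Rightarrow> 'a set \<Rightarrow> bool" where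
  "set_convex sc S \<longleftrightarrow> (\<forall>x\<in>S. \<forall>y\<in>S. \<forall>t::real. 0 \<le> t \<and> t \<le> 1 \<longrightarrow>
      sc (of_real t) x + sc (of_real (1 - t)) y \<in> S)"

definition fun_convex_on :: "('k::real_normed_field \<Rightarrow> 'a::{t2_space,ab_group_add} \<Rightarrow> 'a) \<Rightarrow> 'a set \<Rightarrow> ('a \<Rightarrow> real) \<Rightarrow> bool" where
  "fun_convex_on sc S f \<longleftrightarrow> (\<forall>x\<in>S. \<forall>y\<in>S. \<forall>t::real. 0 \<le> t \<and> t \<le> 1 \<longrightarrow>
      f (sc (of_real t) x + sc (of_real (1 - t)) y) \<le> t * f x + (1 - t) * f y)"

definition gateaux_space :: "('k::real_normed_field \<Rightarrow> 'a::{t2_space,ab_group_add} \<Rightarrow> 'a) \<Rightarrow> bool" where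
  "gateaux_space sc \<longleftrightarrow>
     (\<forall>\<Omega> (f::'a \<Rightarrow> real). \<Omega> \<noteq> {} \<and> open \<Omega> \<and> set_convex sc \<Omega> \<and> continuous_on \<Omega> f
        \<and> fun_convex_on sc \<Omega> f \<longrightarrow>
        (\<exists>S\<subseteq>\<Omega>. \<Omega> \<subseteq> closure S \<and> (\<forall>x\<in>S. gateaux_differentiable_at sc f x)))"

end

theory Submission
  imports Defs "HOL-Library.Function_Algebras"
begin

text \<open>Weak*-closed subsets of a polar are compact by Banach--Alaoglu, and on convex ones the
  hypertopology is that of pointwise convergence of the support functions
  \<open>h\<^sub>F(A) = sup {Re \<sigma>(A) | \<sigma> \<in> F}\<close>. The support functions of the members of
  \<open>CU_U sc U\<close> form a compact set in the product topology, so \<open>CU_U sc U\<close> is a compact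
  Hausdorff space and hence a Baire space.

  Slices of \<open>F\<close> at an extreme point form a neighbourhood base of that point, and every slice
  contains an extreme point. So the extreme points of \<open>F\<close> are dense iff for each of countably many
  pseudometrics (finite sums of evaluations at a dense sequence, with radii \<open>1/(m+1)\<close>) every point
  of \<open>F\<close> is close to some entire slice. The \<open>m\<close>-th condition defines a set \<open>O\<^sub>m\<close> that is
  relatively open in \<open>CU_U sc U\<close>. It is also dense: a finite net of \<open>F\<close> can be perturbed, by infinite-dimensionality, to a linearly independent family,
  whose simplex satisfies the condition. Baire's theorem gives the first part.

  For the second part, a countable base of zero neighbourhoods writes the complement of \<open>D sc\<close>
  in \<open>CU sc\<close> as a countable union of the sets \<open>CU_U sc V - O\<^sub>m\<close>, closed because \<open>CU_U sc V\<close> is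
  closed in \<open>CU sc\<close>. Density follows from the first part after shrinking the zero neighbourhood.\<close>

section \<open>The dual and its polars\<close>

lemma compact_imp_closed_fun:
  fixes S :: "('a \<Rightarrow> 'b::metric_space) set"
  assumes "compact S"
  shows "closed S"
proof -
  have "Hausdorff_space (euclidean :: ('a \<Rightarrow> 'b) topology)"
    unfolding euclidean_product_topology[symmetric] Hausdorff_space_product_topology
    by simp
  moreover have "compactin (euclidean :: ('a \<Rightarrow> 'b) topology) S" using assms by simp
  ultimately have "closedin euclidean S" by (rule compactin_imp_closedin)
  then show ?thesis by simp
qed

text \<open>Tychonoff's theorem; used below both for spaces of functionals and for spaces of support
  functions.\<close>

lemma compact_PiE_UNIV:
  fixes B :: "'a \<Rightarrow> 'b::topological_space set"
  assumes "\<And>i. compact (B i)"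
  shows "compact {f. \<forall>i. f i \<in> B i}"
proof -
  have "compactin (product_topology (\<lambda>_. euclidean) UNIV) (PiE UNIV B)"
    using assms by (simp add: compactin_PiE)
  moreover have "PiE UNIV B = {f. \<forall>i. f i \<in> B i}"
    by (auto simp: PiE_def Pi_def)
  ultimately show ?thesis
    by (simp add: euclidean_product_topology)
qed

lemma continuous_on_eval: "continuous_on S (\<lambda>\<sigma>::'a \<Rightarrow> 'b::topological_space. \<sigma> x)"
  by (rule continuous_on_subset[OF continuous_on_product_coordinates]) simp

lemmas eval_intros = continuous_on_eval continuous_on_const continuous_on_add continuous_on_diff
  continuous_on_mult continuous_on_norm continuous_on_inner continuous_on_sum

text \<open>The scalars are the reals with \<open>cj = id\<close> or the complex numbers with \<open>cj = cnj\<close>;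
  \<open>1 \<bullet> z\<close> is the real part of \<open>z\<close> in both cases.\<close>

locale tvs_dual =
  fixes sc :: "'k::{real_normed_field,euclidean_space} \<Rightarrow> 'a::{t2_space,ab_group_add} \<Rightarrow> 'a"
    and cj :: "'k \<Rightarrow> 'k"
  assumes tvs: "tvs sc"
    and inner_cj: "c \<bullet> z = 1 \<bullet> (cj c * z)"
    and norm_cj: "norm (cj c) = norm c"
begin

abbreviation re :: "'k \<Rightarrow> real" where "re z \<equiv> 1 \<bullet> z"

lemma re_le_norm: "re z \<le> norm z"
  using norm_cauchy_schwarz[of 1 z] by simp

lemma abs_re_le_norm: "\<bar>re z\<bar> \<le> norm z"
  using Cauchy_Schwarz_ineq2[of 1 z] by simp

lemma re_of_real_mult: "re (of_real t * z) = t * re z"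
  by (metis inner_scaleR_right scaleR_conv_of_real)

lemma vs: "Vector_Spaces.vector_space sc"
  using tvs by (simp add: tvs_def)

sublocale V: Vector_Spaces.vector_space sc by (rule vs)

lemma continuous_sc: "continuous_on UNIV (\<lambda>c. sc c x)"
proof -
  have c: "continuous_on UNIV (\<lambda>(c::'k, x::'a). sc c x)"
    using tvs by (simp add: tvs_def)
  show ?thesis
    using continuous_on_compose2[OF c, of UNIV "\<lambda>c. (c, x)"]
    by (simp add: continuous_on_Pair)
qed

lemma continuous_sc_right: "continuous_on UNIV (\<lambda>x. sc c x)"
proof -
  have c: "continuous_on UNIV (\<lambda>(c::'k, x::'a). sc c x)"
    using tvs by (simp add: tvs_def)
  show ?thesis
    using continuous_on_compose2[OF c, of UNIV "\<lambda>x. (c, x)"]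
    by (simp add: continuous_on_Pair)
qed

lemma continuous_translate: "continuous_on UNIV (\<lambda>x. x + a :: 'a)"
proof -
  have c: "continuous_on UNIV (\<lambda>(x::'a, y). x + y)"
    using tvs by (simp add: tvs_def)
  show ?thesis
    using continuous_on_compose2[OF c, of UNIV "\<lambda>x. (x, a)"]
    by (simp add: continuous_on_Pair)
qed

text \<open>Multiples of \<open>A\<close> tend to 0 with the scalar, by continuity of the
  multiplication in the scalar.\<close>

lemma absorbing:
  assumes "zero_nhd U"
  obtains t :: real where "t > 0" "sc (of_real t) A \<in> U"
proof -
  obtain W where W: "open W" "0 \<in> W" "W \<subseteq> U" using assms by (auto simp: zero_nhd_def)
  have "continuous_on UNIV (\<lambda>t::real. sc (of_real t) A)"
    using continuous_on_compose2[OF continuous_sc, of UNIV of_real] by (simp add: continuous_on_of_real)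
  then have "open ((\<lambda>t::real. sc (of_real t) A) -` W)"
    using W(1) by (simp add: open_vimage)
  moreover have "0 \<in> (\<lambda>t::real. sc (of_real t) A) -` W" using W by simp
  ultimately obtain e where "e > 0" "ball 0 e \<subseteq> (\<lambda>t::real. sc (of_real t) A) -` W"
    by (meson openE)
  then show ?thesis using that[of "e/2"] W(3) by (auto simp: subset_eq simp del: of_real_divide)
qed

lemma tdual_iff:
  "\<sigma> \<in> tdual sc \<longleftrightarrow> (\<forall>x y. \<sigma> (x + y) = \<sigma> x + \<sigma> y) \<and> (\<forall>c x. \<sigma> (sc c x) = c * \<sigma> x) \<and> continuous_on UNIV \<sigma>"
proof -
  have vs': "Vector_Spaces.vector_space ((*) :: 'k \<Rightarrow> 'k \<Rightarrow> 'k)"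
    by unfold_locales (auto simp: algebra_simps)
  show ?thesis
    unfolding tdual_def by (auto simp: Vector_Spaces.linear_iff vs vs')
qed

lemma tdual_add: "\<sigma> \<in> tdual sc \<Longrightarrow> \<sigma> (x + y) = \<sigma> x + \<sigma> y"
  and tdual_scale: "\<sigma> \<in> tdual sc \<Longrightarrow> \<sigma> (sc c x) = c * \<sigma> x"
  and tdual_cont: "\<sigma> \<in> tdual sc \<Longrightarrow> continuous_on UNIV \<sigma>"
  by (auto simp: tdual_iff)

lemma tdual_zero: "\<sigma> \<in> tdual sc \<Longrightarrow> \<sigma> 0 = 0"
  by (metis tdual_add add_0 add_left_cancel add.right_neutral)

lemma tdual_diff: "\<sigma> \<in> tdual sc \<Longrightarrow> \<sigma> (x - y) = \<sigma> x - \<sigma> y"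
  by (metis tdual_add add_diff_cancel_right' diff_add_cancel)

lemma tdual_sum: "\<sigma> \<in> tdual sc \<Longrightarrow> \<sigma> (\<Sum>i\<in>I. f i) = (\<Sum>i\<in>I. \<sigma> (f i))"
  by (induction I rule: infinite_finite_induct) (auto simp: tdual_zero tdual_add)

lemma polar_tdual: "\<sigma> \<in> polar sc U \<Longrightarrow> \<sigma> \<in> tdual sc"
  by (simp add: polar_def)

text \<open>A linear functional bounded by 1 on a zero neighbourhood is automatically continuous.
  The remaining conditions are closed under pointwise limits, which is what compactness of the polar
  rests on.\<close>

lemma polar_eq:
  assumes "zero_nhd U"
  shows "polar sc U = {\<sigma>. (\<forall>x y. \<sigma> (x + y) = \<sigma> x + \<sigma> y) \<and> (\<forall>c x. \<sigma> (sc c x) = c * \<sigma> x)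
    \<and> (\<forall>A\<in>U. norm (\<sigma> A) \<le> 1)}"
proof -
  obtain W where W: "open W" "0 \<in> W" "W \<subseteq> U" using assms by (auto simp: zero_nhd_def)
  have "continuous_on UNIV \<sigma>"
    if add: "\<And>x y. \<sigma> (x + y) = \<sigma> x + \<sigma> y" and sca: "\<And>c x. \<sigma> (sc c x) = c * \<sigma> x"
      and U: "\<And>A. A \<in> U \<Longrightarrow> norm (\<sigma> A) \<le> 1" for \<sigma>
  proof -
    have "\<forall>\<^sub>F y in at x. dist (\<sigma> y) (\<sigma> x) < e" if "e > 0" for x and e :: real
    proof -
      \<comment> \<open>The factor \<open>2/e\<close> turns the bound 1 on \<open>W\<close> into a
        bound \<open>e/2\<close> on the increment, strictly below \<open>e\<close>.\<close>
      let ?N = "{y. sc (of_real (2/e)) (y + (-x)) \<in> W}"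
      have "continuous_on UNIV (\<lambda>y. sc (of_real (2/e)) (y + (-x)))"
        using continuous_on_compose2[OF continuous_sc_right continuous_translate] by blast
      then have "open ?N"
        using open_vimage[OF W(1)] by (simp add: vimage_def)
      moreover have "x \<in> ?N" using W by simp
      moreover have "dist (\<sigma> y) (\<sigma> x) < e" if "y \<in> ?N" for y
      proof -
        have "norm (\<sigma> (sc (of_real (2/e)) (y - x))) \<le> 1"
          using that W(3) by (intro U) auto
        then have "norm (of_real (2/e) * \<sigma> (y - x)) \<le> 1" by (simp only: sca)
        then have "2/e * norm (\<sigma> (y - x)) \<le> 1" using \<open>e > 0\<close> by (simp add: norm_mult norm_divide)
        moreover have "\<sigma> (y - x) = \<sigma> y - \<sigma> x"
          by (metis add add_diff_cancel_right' diff_add_cancel)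
        ultimately show ?thesis using \<open>e > 0\<close> by (simp add: dist_norm field_simps)
      qed
      ultimately show ?thesis unfolding eventually_at_topological by blast
    qed
    then show ?thesis by (simp add: continuous_on_def tendsto_iff)
  qed
  then show ?thesis unfolding polar_def tdual_iff by blast
qed

lemma polar_bounded:
  assumes "zero_nhd U"
  obtains M where "\<forall>\<sigma>\<in>polar sc U. norm (\<sigma> A) \<le> M" "M \<ge> 0"
proof -
  obtain t where t: "t > 0" "sc (of_real t) A \<in> U" using absorbing[OF assms] .
  have "norm (\<sigma> A) \<le> 1 / t" if "\<sigma> \<in> polar sc U" for \<sigma>
  proof -
    have "norm (\<sigma> (sc (of_real t) A)) \<le> 1" using that t by (auto simp: polar_def)
    then show ?thesis
      using t(1) that by (simp add: tdual_scale polar_tdual norm_mult field_simps)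
  qed
  then show ?thesis using that[of "1 / t"] t by simp
qed

text \<open>Banach-Alaoglu: the polar is a closed subset of a product of closed balls with radii
  from \<open>polar_bounded\<close>.\<close>

lemma polar_compact:
  assumes "zero_nhd U"
  shows "compact (polar sc U)"
proof -
  have "\<forall>A. \<exists>M. \<forall>\<sigma>\<in>polar sc U. norm (\<sigma> A) \<le> M"
    by (intro allI, rule polar_bounded[OF assms]) blast
  then obtain M where M: "\<And>A \<sigma>. \<sigma> \<in> polar sc U \<Longrightarrow> norm (\<sigma> A) \<le> M A"
    by metis
  have "compact {\<sigma>. \<forall>A. \<sigma> A \<in> cball (0::'k) (M A)}"
    by (rule compact_PiE_UNIV) simp
  moreover have "closed (polar sc U)"
  proof -
    have "closed {\<sigma>::'a \<Rightarrow> 'k. \<sigma> (x + y) = \<sigma> x + \<sigma> y}" for x y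
      by (rule closed_Collect_eq) (intro eval_intros)+
    moreover have "closed {\<sigma>::'a \<Rightarrow> 'k. \<sigma> (sc c x) = c * \<sigma> x}" for c x
      by (rule closed_Collect_eq) (intro eval_intros)+
    moreover have "closed {\<sigma>::'a \<Rightarrow> 'k. norm (\<sigma> x) \<le> 1}" for x
      by (rule closed_Collect_le) (intro eval_intros)+
    moreover have "polar sc U = (\<Inter>x. \<Inter>y. {\<sigma>. \<sigma> (x + y) = \<sigma> x + \<sigma> y})
        \<inter> (\<Inter>c. \<Inter>x. {\<sigma>. \<sigma> (sc c x) = c * \<sigma> x}) \<inter> (\<Inter>x\<in>U. {\<sigma>. norm (\<sigma> x) \<le> 1})"
      unfolding polar_eq[OF assms] by blast
    ultimately show ?thesis by (simp add: closed_INT closed_Int)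
  qed
  ultimately have "compact ({\<sigma>. \<forall>A. \<sigma> A \<in> cball (0::'k) (M A)} \<inter> polar sc U)"
    by (rule compact_Int_closed)
  moreover have "{\<sigma>. \<forall>A. \<sigma> A \<in> cball (0::'k) (M A)} \<inter> polar sc U = polar sc U"
    using M by auto
  ultimately show ?thesis by simp
qed

text \<open>Inside the compact polar, closed and compact coincide, so later arguments can use
  compactness in the product topology and leave \<open>weakstar\<close> aside.\<close>

lemma CU_U_iff:
  assumes "zero_nhd U"
  shows "F \<in> CU_U sc U \<longleftrightarrow> F \<noteq> {} \<and> fconvex F \<and> compact F \<and> F \<subseteq> polar sc U"
proof -
  have "closedin (weakstar sc) F \<longleftrightarrow> compact F" if F: "F \<subseteq> polar sc U"
  proof
    assume "closedin (weakstar sc) F"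
    then obtain C where C: "closed C" "F = C \<inter> tdual sc"
      unfolding weakstar_def euclidean_product_topology closedin_subtopology
      by auto
    then have "F = polar sc U \<inter> C" using F by (auto simp: polar_def)
    then show "compact F" using C polar_compact[OF assms] by (auto intro: compact_Int_closed)
  next
    assume "compact F"
    then have "closed F" by (rule compact_imp_closed_fun)
    moreover have "F = F \<inter> tdual sc" using F polar_tdual by blast
    ultimately show "closedin (weakstar sc) F"
      unfolding weakstar_def euclidean_product_topology closedin_subtopology
      by auto
  qed
  then show ?thesis unfolding CU_U_def by auto
qed

text \<open>A compact \<open>F\<close> inside the dual is closed in the full function space, so the
  closure of \<open>E\<close> acquires no points outside the dual.\<close>

lemma weakstar_closure:
  assumes "E \<subseteq> F" "compact F" "F \<subseteq> tdual sc"
  shows "weakstar sc closure_of E = closure E"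
proof -
  have "closure E \<subseteq> F" using assms compact_imp_closed_fun closure_minimal by blast
  moreover have "tdual sc \<inter> E = E" using assms by blast
  ultimately show ?thesis
    unfolding weakstar_def euclidean_product_topology closure_of_subtopology
    using assms by auto
qed

end

section \<open>Convexity, separation and slices\<close>

text \<open>A basic open set of the product restricts finitely many coordinates, so a single radius
  serves all of them.\<close>

lemma open_fun_basis:
  fixes f :: "'a \<Rightarrow> 'b::metric_space"
  assumes "open W" "f \<in> W"
  obtains I e where "finite I" "e > 0" "\<forall>g. (\<forall>i\<in>I. dist (g i) (f i) < e) \<longrightarrow> g \<in> W"
proof -
  have "openin (product_topology (\<lambda>_. euclidean) UNIV) W"
    using assms(1) by (simp add: euclidean_product_topology)
  then obtain V where V: "finite {i. V i \<noteq> UNIV}" "\<And>i. open (V i)" "f \<in> PiE UNIV V" "PiE UNIV V \<subseteq> W"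
    using assms(2) unfolding openin_product_topology_alt by force
  let ?I = "{i. V i \<noteq> UNIV}"
  have "\<exists>e>0. \<forall>y. dist y (f i) < e \<longrightarrow> y \<in> V i" for i
    using V(2)[of i] V(3) by (auto simp: open_dist PiE_iff)
  then obtain r where r: "\<And>i. r i > 0" "\<And>i y. dist y (f i) < r i \<Longrightarrow> y \<in> V i"
    by metis
  show thesis
  \<comment> \<open>\<open>insert 1\<close> keeps the minimum defined when no coordinate is
    restricted.\<close>
  proof (rule that[of ?I "Min (insert 1 (r ` ?I))"])
    show "Min (insert 1 (r ` ?I)) > 0" using V(1) r(1) by simp
    have "g i \<in> V i" if g: "\<forall>i\<in>?I. dist (g i) (f i) < Min (insert 1 (r ` ?I))" for g i
    proof (cases "i \<in> ?I")
      case True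
      have "Min (insert 1 (r ` ?I)) \<le> r i" using V(1) True by (intro Min_le) auto
      then show ?thesis using bspec[OF g True] r(2)[of "g i" i] by linarith
    qed auto
    then show "\<forall>g. (\<forall>i\<in>?I. dist (g i) (f i) < Min (insert 1 (r ` ?I))) \<longrightarrow> g \<in> W"
      using V(4) by (auto simp: PiE_iff)
  qed (use V in auto)
qed

section \<open>Convex combinations and joins of convex sets\<close>

definition cmb :: "real \<Rightarrow> ('a \<Rightarrow> 'k) \<Rightarrow> ('a \<Rightarrow> 'k) \<Rightarrow> 'a \<Rightarrow> 'k::real_normed_field" where
  "cmb t f g = (\<lambda>x. of_real t * f x + of_real (1 - t) * g x)"

lemma cmb_self [simp]: "cmb t f f = f"
  by (simp add: cmb_def fun_eq_iff algebra_simps)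

lemma cmb_0 [simp]: "cmb 0 f g = g" and cmb_1 [simp]: "cmb 1 f g = f"
  by (auto simp: cmb_def)

lemma fconvexD: "fconvex F \<Longrightarrow> f \<in> F \<Longrightarrow> g \<in> F \<Longrightarrow> 0 \<le> t \<Longrightarrow> t \<le> 1 \<Longrightarrow> cmb t f g \<in> F"
  by (simp add: fconvex_def cmb_def)

lemma fconvexI: "(\<And>f g t. f \<in> F \<Longrightarrow> g \<in> F \<Longrightarrow> 0 \<le> t \<Longrightarrow> t \<le> 1 \<Longrightarrow> cmb t f g \<in> F) \<Longrightarrow> fconvex F"
  by (simp add: fconvex_def cmb_def)

lemma extreme_pointsI:
  "\<sigma> \<in> F \<Longrightarrow> (\<And>f g t. f \<in> F \<Longrightarrow> g \<in> F \<Longrightarrow> 0 < t \<Longrightarrow> t < 1 \<Longrightarrow> \<sigma> = cmb t f g \<Longrightarrow> f = g) \<Longrightarrow> \<sigma> \<in> extreme_points F"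
  unfolding extreme_points_def cmb_def by blast

lemma extreme_pointsD:
  "\<sigma> \<in> extreme_points F \<Longrightarrow> f \<in> F \<Longrightarrow> g \<in> F \<Longrightarrow> 0 < t \<Longrightarrow> t < 1 \<Longrightarrow> \<sigma> = cmb t f g \<Longrightarrow> f = g"
  unfolding extreme_points_def cmb_def by blast

lemma extreme_points_subset: "extreme_points F \<subseteq> F"
  by (auto simp: extreme_points_def)

text \<open>For nonempty convex sets this is the convex hull of the union; being the image of a
  product, it inherits compactness from \<open>C\<close> and \<open>E\<close>. It is empty as soon
  as one of the two sets is.\<close>

definition join :: "('a \<Rightarrow> 'k::real_normed_field) set \<Rightarrow> ('a \<Rightarrow> 'k) set \<Rightarrow> ('a \<Rightarrow> 'k) set" where
  "join C E = {cmb t f g | t f g. 0 \<le> t \<and> t \<le> 1 \<and> f \<in> C \<and> g \<in> E}"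

lemma joinI: "0 \<le> t \<Longrightarrow> t \<le> 1 \<Longrightarrow> f \<in> C \<Longrightarrow> g \<in> E \<Longrightarrow> cmb t f g \<in> join C E"
  by (auto simp: join_def)

lemma join_superset1: "E \<noteq> {} \<Longrightarrow> C \<subseteq> join C E"
  using joinI[of 1 _ C _ E] by auto

lemma join_superset2: "C \<noteq> {} \<Longrightarrow> E \<subseteq> join C E"
  using joinI[of 0 _ C _ E] by auto

lemma join_subset: "fconvex F \<Longrightarrow> C \<subseteq> F \<Longrightarrow> E \<subseteq> F \<Longrightarrow> join C E \<subseteq> F"
  by (auto simp: join_def intro!: fconvexD)

lemma compact_join:
  assumes "compact C" "compact E"
  shows "compact (join C E)"
proof -
  let ?h = "\<lambda>z :: real \<times> ('a \<Rightarrow> 'b) \<times> ('a \<Rightarrow> 'b). cmb (fst z) (fst (snd z)) (snd (snd z))"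
  have "continuous_on UNIV (\<lambda>z. ?h z x)" for x
    unfolding cmb_def
    by (intro continuous_on_add continuous_on_mult continuous_on_of_real continuous_on_diff
        continuous_on_const continuous_on_fst continuous_on_snd continuous_on_id
        continuous_on_compose2[OF continuous_on_eval, where t = UNIV]) auto
  then have "continuous_on UNIV ?h"
    by (rule continuous_on_coordinatewise_then_product)
  then have "compact (?h ` ({0..1} \<times> C \<times> E))"
    by (intro compact_continuous_image compact_Times assms compact_Icc) (rule continuous_on_subset, auto)
  moreover have "join C E = ?h ` ({0..1} \<times> C \<times> E)"
    by (force simp: join_def image_iff)
  ultimately show ?thesis by simp
qed

text \<open>Serves to gather two nonnegative multiples of points of \<open>C\<close> into one
  multiple of a point of \<open>C\<close>. If the total weight vanishes, any point of
  \<open>C\<close> will do.\<close>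

lemma fconvex_rescale:
  assumes "fconvex C" "f \<in> C" "g \<in> C" "0 \<le> \<alpha>" "0 \<le> \<beta>"
  obtains h where "h \<in> C" "\<And>x. of_real (\<alpha> + \<beta>) * h x = of_real \<alpha> * f x + of_real \<beta> * g x"
proof (cases "\<alpha> + \<beta> = 0")
  case True
  then have "\<alpha> = 0" "\<beta> = 0" using assms by auto
  then show ?thesis using that[of f] assms by simp
next
  case False
  then have pos: "\<alpha> + \<beta> > 0" using assms by simp
  let ?t = "\<alpha> / (\<alpha> + \<beta>)"
  have t: "(\<alpha> + \<beta>) * ?t = \<alpha>" "(\<alpha> + \<beta>) * (1 - ?t) = \<beta>"
    using pos by (auto simp: field_simps)
  have "of_real (\<alpha> + \<beta>) * cmb ?t f g x = of_real ((\<alpha> + \<beta>) * ?t) * f x + of_real ((\<alpha> + \<beta>) * (1 - ?t)) * g x" for x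
    unfolding cmb_def of_real_mult by (simp only: distrib_left mult.assoc)
  then have "of_real (\<alpha> + \<beta>) * cmb ?t f g x = of_real \<alpha> * f x + of_real \<beta> * g x" for x
    unfolding t .
  moreover have "cmb ?t f g \<in> C"
    using assms pos by (intro fconvexD) auto
  ultimately show ?thesis using that by blast
qed

text \<open>The contributions from \<open>C\<close> are gathered into one point, likewise those from
  \<open>E\<close>; the two total weights add up to 1.\<close>

lemma fconvex_join:
  assumes "fconvex C" "fconvex E"
  shows "fconvex (join C E)"
proof (rule fconvexI)
  fix p p' :: "'a \<Rightarrow> 'b" and s :: real assume "p \<in> join C E" "p' \<in> join C E" and s: "0 \<le> s" "s \<le> 1"
  then obtain t f g t' f' g' where p: "p = cmb t f g" "0 \<le> t" "t \<le> 1" "f \<in> C" "g \<in> E"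
    and p': "p' = cmb t' f' g'" "0 \<le> t'" "t' \<le> 1" "f' \<in> C" "g' \<in> E"
    unfolding join_def by blast
  obtain h where h: "h \<in> C" "\<And>x. of_real (s * t + (1 - s) * t') * h x = of_real (s * t) * f x + of_real ((1 - s) * t') * f' x"
    using fconvex_rescale[OF assms(1) p(4) p'(4), of "s * t" "(1 - s) * t'"] p p' s by auto
  obtain k where k: "k \<in> E" "\<And>x. of_real (s * (1 - t) + (1 - s) * (1 - t')) * k x
      = of_real (s * (1 - t)) * g x + of_real ((1 - s) * (1 - t')) * g' x"
    using fconvex_rescale[OF assms(2) p(5) p'(5), of "s * (1 - t)" "(1 - s) * (1 - t')"] p p' s by auto
  let ?u = "s * t + (1 - s) * t'"
  have u: "1 - ?u = s * (1 - t) + (1 - s) * (1 - t')" by (simp add: algebra_simps)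
  have "cmb s p p' = cmb ?u h k"
  proof
    fix x
    have "cmb ?u h k x = of_real (s * t) * f x + of_real ((1 - s) * t') * f' x
      + (of_real (s * (1 - t)) * g x + of_real ((1 - s) * (1 - t')) * g' x)"
      unfolding cmb_def u h(2) k(2) ..
    also have "\<dots> = cmb s p p' x" by (simp add: cmb_def p(1) p'(1) algebra_simps)
    finally show "cmb s p p' x = cmb ?u h k x" ..
  qed
  moreover have "0 \<le> ?u" using s p p' by simp
  moreover have "0 \<le> 1 - ?u" unfolding u using s p p' by simp
  ultimately show "cmb s p p' \<in> join C E"
    using joinI[of ?u h C k E] h(1) k(1) by simp
qed

section \<open>Separation by evaluations and slices at extreme points\<close>

context tvs_dual begin

lemma re_cmb: "re (cmb t f g x) = t * re (f x) + (1 - t) * re (g x)"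
  unfolding cmb_def by (simp only: inner_add_right re_of_real_mult)

lemma tdual_cmb: "f \<in> tdual sc \<Longrightarrow> g \<in> tdual sc \<Longrightarrow> cmb t f g \<in> tdual sc"
  unfolding tdual_iff cmb_def by (auto simp: algebra_simps intro!: continuous_intros)

lemma fconvex_halfspace: "fconvex F \<Longrightarrow> fconvex {\<tau>\<in>F. c \<le> re (\<tau> A)}"
proof (rule fconvexI)
  fix f g and t :: real
  assume F: "fconvex F" and f: "f \<in> {\<tau>\<in>F. c \<le> re (\<tau> A)}" and g: "g \<in> {\<tau>\<in>F. c \<le> re (\<tau> A)}"
    and t: "0 \<le> t" "t \<le> 1"
  have "t * c + (1 - t) * c \<le> t * re (f A) + (1 - t) * re (g A)"
    using f g t by (intro add_mono mult_left_mono) auto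
  then show "cmb t f g \<in> {\<tau>\<in>F. c \<le> re (\<tau> A)}"
    using fconvexD[OF F, of f g t] f g t by (simp add: re_cmb algebra_simps)
qed

lemma continuous_re_eval: "continuous_on S (\<lambda>\<sigma>::'a \<Rightarrow> 'k. re (\<sigma> A))"
  by (intro continuous_on_inner continuous_on_const continuous_on_eval)

lemma open_halfspace: "open {\<sigma>::'a \<Rightarrow> 'k. c < re (\<sigma> A)}"
  by (intro open_Collect_less continuous_on_const continuous_re_eval)

lemma closed_halfspace: "closed {\<sigma>::'a \<Rightarrow> 'k. c \<le> re (\<sigma> A)}"
  by (intro closed_Collect_le continuous_on_const continuous_re_eval)

lemma compact_halfspace:
  fixes F :: "('a \<Rightarrow> 'k) set"
  shows "compact F \<Longrightarrow> compact {\<sigma>\<in>F. c \<le> re (\<sigma> A)}"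
  using compact_Int_closed[OF _ closed_halfspace, of F c A] by (simp add: Int_def)

text \<open>A neighbourhood of \<kappa> that misses \<open>F\<close> restricts finitely many
  coordinates, so the problem reduces to nearest-point projection in a finite-dimensional Euclidean
  space. The normal vector found there acts as evaluation at one vector \<open>A\<close>.\<close>

lemma separation:
  assumes F: "fconvex F" "compact F" "F \<subseteq> tdual sc" and \<kappa>: "\<kappa> \<in> tdual sc" "\<kappa> \<notin> F"
  obtains A c where "\<And>\<sigma>. \<sigma> \<in> F \<Longrightarrow> re (\<sigma> A) < c" "c < re (\<kappa> A)"
proof (cases "F = {}")
  case True
  then show thesis using that[of 0 "-1"] \<kappa> by (simp add: tdual_zero)
next
  case False
  have "open (- F)" "\<kappa> \<in> - F" using F(2) \<kappa>(2) compact_imp_closed_fun by blast+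
  then obtain I e where I: "finite I" "e > 0" "\<forall>g. (\<forall>i\<in>I. dist (g i) (\<kappa> i) < e) \<longrightarrow> g \<in> - F"
    by (rule open_fun_basis)
  let ?\<phi> = "\<lambda>\<sigma>::'a \<Rightarrow> 'k. \<Sum>i\<in>I. (\<kappa> i - \<sigma> i) \<bullet> (\<kappa> i - \<sigma> i)"
  have "continuous_on F ?\<phi>"
    by (intro continuous_on_sum continuous_on_inner continuous_on_diff continuous_on_const continuous_on_eval)
  then obtain \<sigma>0 where \<sigma>0: "\<sigma>0 \<in> F" "\<And>\<sigma>. \<sigma> \<in> F \<Longrightarrow> ?\<phi> \<sigma>0 \<le> ?\<phi> \<sigma>"
    using continuous_attains_inf[OF F(2) False] by blast
  define d where "d i = \<kappa> i - \<sigma>0 i" for i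
  \<comment> \<open>The coefficients \<open>cj (d i)\<close> make the pairing with the normal vector
    \<open>d\<close> the real part of an evaluation; linearity of the functionals collects the
    finitely many points into \<open>A\<close>.\<close>
  define A where "A = (\<Sum>i\<in>I. sc (cj (d i)) i)"
  have evA: "re (\<sigma> A) = (\<Sum>i\<in>I. d i \<bullet> \<sigma> i)" if "\<sigma> \<in> tdual sc" for \<sigma>
    using that by (simp add: A_def tdual_sum tdual_scale inner_sum_right inner_cj[of "d _"])
  have le: "re (\<sigma> A) \<le> re (\<sigma>0 A)" if \<sigma>: "\<sigma> \<in> F" for \<sigma>
  proof -
    define S Q where "S = (\<Sum>i\<in>I. d i \<bullet> (\<sigma> i - \<sigma>0 i))" and "Q = (\<Sum>i\<in>I. (\<sigma> i - \<sigma>0 i) \<bullet> (\<sigma> i - \<sigma>0 i))"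
    have Q: "Q \<ge> 0" unfolding Q_def by (simp add: sum_nonneg)
    \<comment> \<open>First variation at the minimiser: \<sigma>0 is compared with the point at
      parameter \<open>t\<close> on the segment towards \<sigma>, and the inequality is divided by
      \<open>t\<close>.\<close>
    have key: "2 * S \<le> t * Q" if t: "0 < t" "t \<le> 1" for t
    proof -
      have eq: "\<kappa> i - cmb t \<sigma> \<sigma>0 i = d i - t *\<^sub>R (\<sigma> i - \<sigma>0 i)" for i
        by (simp add: cmb_def d_def scaleR_conv_of_real algebra_simps)
      have "?\<phi> \<sigma>0 \<le> ?\<phi> (cmb t \<sigma> \<sigma>0)"
        using \<sigma> \<sigma>0(1) t F(1) by (intro \<sigma>0(2) fconvexD) auto
      also have "\<dots> = (\<Sum>i\<in>I. d i \<bullet> d i - 2 * t * (d i \<bullet> (\<sigma> i - \<sigma>0 i)) + t\<^sup>2 * ((\<sigma> i - \<sigma>0 i) \<bullet> (\<sigma> i - \<sigma>0 i)))"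
        unfolding eq by (rule sum.cong) (auto simp: inner_diff_left inner_diff_right inner_commute power2_eq_square algebra_simps)
      also have "\<dots> = ?\<phi> \<sigma>0 - 2 * t * S + t\<^sup>2 * Q"
        by (simp add: sum.distrib sum_subtractf sum_distrib_left S_def Q_def d_def)
      finally have "t * (2 * S) \<le> t * (t * Q)" by (simp add: power2_eq_square algebra_simps)
      then show ?thesis using t(1) by simp
    qed
    have "S \<le> 0"
    proof (rule ccontr)
      assume "\<not> S \<le> 0"
      \<comment> \<open>This \<open>t\<close> makes \<open>t * Q\<close> at most \<open>S\<close>,
        while \<open>key\<close> gives \<open>2 * S \<le> t * Q\<close>.\<close>
      define t where "t = min 1 (S / (Q + 1))"
      have "0 < t" "t \<le> 1" using \<open>\<not> S \<le> 0\<close> Q by (auto simp: t_def)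
      from key[OF this] have "2 * S \<le> t * Q" .
      also have "\<dots> \<le> S / (Q + 1) * Q" using Q by (intro mult_right_mono) (auto simp: t_def)
      also have "\<dots> \<le> S" using Q \<open>\<not> S \<le> 0\<close> by (simp add: field_simps)
      finally show False using \<open>\<not> S \<le> 0\<close> by simp
    qed
    then show ?thesis
      using evA[OF subsetD[OF F(3) \<sigma>]] evA[OF subsetD[OF F(3) \<sigma>0(1)]]
      by (simp add: S_def inner_diff_right sum_subtractf)
  qed
  \<comment> \<open>Otherwise \<sigma>0 would agree with \<kappa> on \<open>I\<close> and so lie in
    the neighbourhood that misses \<open>F\<close>.\<close>
  have "\<exists>i\<in>I. d i \<noteq> 0"
  proof (rule ccontr)
    assume "\<not> (\<exists>i\<in>I. d i \<noteq> 0)"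
    then have "\<sigma>0 \<in> - F" using I(2) by (intro I(3)[rule_format]) (auto simp: d_def)
    then show False using \<sigma>0(1) by simp
  qed
  then have "0 < (\<Sum>i\<in>I. d i \<bullet> d i)"
    using I(1) by (auto intro!: sum_pos2)
  also have "\<dots> = re (\<kappa> A) - re (\<sigma>0 A)"
    using evA[OF \<kappa>(1)] evA[OF subsetD[OF F(3) \<sigma>0(1)]]
    by (simp add: d_def inner_diff_right flip: sum_subtractf)
  finally have "re (\<sigma>0 A) < re (\<kappa> A)" by simp
  then obtain c where "re (\<sigma>0 A) < c" "c < re (\<kappa> A)" using dense by blast
  then show thesis using le that[of A c] by fastforce
qed

lemma separate_points:
  assumes "e \<in> tdual sc" "\<kappa> \<in> tdual sc" "e \<noteq> \<kappa>"
  obtains A c where "re (e A) < c" "c < re (\<kappa> A)"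
proof (rule separation[of "{e}" \<kappa>])
  show "fconvex {e}" by (rule fconvexI) auto
qed (use assms that in auto)

text \<open>An extreme point avoids the convex hull of finitely many compact convex subsets that avoid it,
  so it can be separated from the complement of any of its neighbourhoods.\<close>

lemma extreme_point_slice:
  assumes F: "fconvex F" "compact F" "F \<subseteq> tdual sc" and e: "e \<in> extreme_points F"
    and W: "open W" "e \<in> W"
  obtains A c where "c < re (e A)" "\<forall>\<tau>\<in>F. c \<le> re (\<tau> A) \<longrightarrow> \<tau> \<in> W"
proof -
  have eF: "e \<in> F" using e extreme_points_subset by blast
  have comp: "compact (F - W)" using F(2) W(1) by (rule compact_diff)
  have "\<exists>p. re (e (fst p)) < snd p \<and> snd p < re (\<kappa> (fst p))" if \<kappa>: "\<kappa> \<in> F - W" for \<kappa>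
  proof -
    obtain A c where "re (e A) < c" "c < re (\<kappa> A)"
      using separate_points[of e \<kappa>] eF F(3) \<kappa> W(2) by blast
    then show ?thesis by (intro exI[of _ "(A, c)"]) simp
  qed
  then obtain p where p: "\<And>\<kappa>. \<kappa> \<in> F - W \<Longrightarrow> re (e (fst (p \<kappa>))) < snd (p \<kappa>) \<and> snd (p \<kappa>) < re (\<kappa> (fst (p \<kappa>)))"
    by metis
  \<comment> \<open>Finitely many open half-spaces, each avoiding \<open>e\<close>, cover the part
    of \<open>F\<close> outside \<open>W\<close>.\<close>
  obtain E where E: "E \<subseteq> F - W" "finite E" "F - W \<subseteq> (\<Union>\<kappa>\<in>E. {\<tau>. snd (p \<kappa>) < re (\<tau> (fst (p \<kappa>)))})"
  proof (rule compactE_image[OF comp, of "F - W" "\<lambda>\<kappa>. {\<tau>. snd (p \<kappa>) < re (\<tau> (fst (p \<kappa>)))}"])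
    show "F - W \<subseteq> (\<Union>\<kappa>\<in>F - W. {\<tau>. snd (p \<kappa>) < re (\<tau> (fst (p \<kappa>)))})" using p by blast
  qed (auto intro: open_halfspace)
  \<comment> \<open>By induction on the half-spaces, the corresponding slices of \<open>F\<close>
    are enclosed in one compact convex subset of \<open>F\<close> that still avoids
    \<open>e\<close>.\<close>
  have "\<exists>C. compact C \<and> fconvex C \<and> C \<subseteq> F \<and> e \<notin> C \<and> (\<forall>q\<in>P. {\<tau>\<in>F. snd q \<le> re (\<tau> (fst q))} \<subseteq> C)"
    if "finite P" "\<And>q. q \<in> P \<Longrightarrow> re (e (fst q)) < snd q" for P
    using that
  proof (induction P rule: finite_induct)
    case empty
    show ?case by (intro exI[of _ "{}"]) (auto simp: fconvex_def)
  next
    case (insert q P)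
    then obtain C where C: "compact C" "fconvex C" "C \<subseteq> F" "e \<notin> C"
      "\<forall>q\<in>P. {\<tau>\<in>F. snd q \<le> re (\<tau> (fst q))} \<subseteq> C"
      by auto
    define H where "H = {\<tau>\<in>F. snd q \<le> re (\<tau> (fst q))}"
    have H: "compact H" "fconvex H" "H \<subseteq> F" "e \<notin> H"
      using compact_halfspace fconvex_halfspace F insert.prems[of q] by (auto simp: H_def)
    \<comment> \<open>Empty sets are treated apart because a \<open>join\<close> with an empty set
      is empty.\<close>
    consider "C = {}" | "H = {}" | "C \<noteq> {}" "H \<noteq> {}" by blast
    then show ?case
    proof cases
      case 1 then show ?thesis using H C by (intro exI[of _ H]) (auto simp: H_def)
    next
      case 2 then show ?thesis using H C by (intro exI[of _ C]) (auto simp: H_def)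
    next
      case 3
      have "e \<notin> join C H"
      proof
        assume "e \<in> join C H"
        then obtain t f g where t: "e = cmb t f g" "0 \<le> t" "t \<le> 1" "f \<in> C" "g \<in> H"
          unfolding join_def by blast
        have "t \<noteq> 0" "t \<noteq> 1" using t C(4) H(4) by auto
        \<comment> \<open>Here extremality enters: a proper combination equal to \<open>e\<close>
          has equal endpoints, which forces \<open>e\<close> into \<open>C\<close>.\<close>
        then have "f = g" using t C(3) H(3) by (intro extreme_pointsD[OF e, of f g t]) auto
        then show False using t C(4) by simp
      qed
      then show ?thesis
        using join_superset1[OF 3(2), of C] join_superset2[OF 3(1), of H] C H
          compact_join[OF C(1) H(1)] fconvex_join[OF C(2) H(2)] join_subset[OF F(1) C(3) H(3)]
        by (intro exI[of _ "join C H"]) (simp add: H_def[symmetric], blast)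
    qed
  qed
  from this[of "p ` E"] have "\<exists>C. compact C \<and> fconvex C \<and> C \<subseteq> F \<and> e \<notin> C
      \<and> (\<forall>q\<in>p ` E. {\<tau>\<in>F. snd q \<le> re (\<tau> (fst q))} \<subseteq> C)"
    using E(1,2) p by fastforce
  then obtain C where C: "compact C" "fconvex C" "C \<subseteq> F" "e \<notin> C"
    "\<forall>q\<in>p ` E. {\<tau>\<in>F. snd q \<le> re (\<tau> (fst q))} \<subseteq> C"
    by blast
  obtain A c where A: "\<And>\<sigma>. \<sigma> \<in> C \<Longrightarrow> re (\<sigma> A) < c" "c < re (e A)"
    using separation[OF C(2,1) _ _ C(4)] C(3) F(3) eF by blast
  have "\<tau> \<in> W" if "\<tau> \<in> F" "c \<le> re (\<tau> A)" for \<tau>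
  proof (rule ccontr)
    assume "\<tau> \<notin> W"
    then have "\<tau> \<in> F - W" using that(1) by blast
    then obtain \<kappa> where "\<kappa> \<in> E" "snd (p \<kappa>) < re (\<tau> (fst (p \<kappa>)))" using E(3) by blast
    then have "\<tau> \<in> C" using C(5) that(1) by force
    then show False using A(1) that(2) by fastforce
  qed
  then show thesis using A(2) that by blast
qed

lemma compact_attains_re:
  fixes F :: "('a \<Rightarrow> 'k) set"
  assumes "compact F" "F \<noteq> {}"
  obtains \<sigma> where "\<sigma> \<in> F" "\<And>\<tau>. \<tau> \<in> F \<Longrightarrow> re (\<tau> A) \<le> re (\<sigma> A)"
  using continuous_attains_sup[OF assms continuous_re_eval] by blast

text \<open>A strictly convex weak*-continuous function, maximised over the face of the maximisers of
  \<open>A\<close>, singles out an extreme point.\<close>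

lemma extreme_point_maximizer:
  fixes a :: "nat \<Rightarrow> 'a"
  assumes dense: "\<forall>W. open W \<and> W \<noteq> {} \<longrightarrow> (\<exists>n. a n \<in> W)"
    and U: "zero_nhd U" and F: "fconvex F" "compact F" "F \<noteq> {}" "F \<subseteq> polar sc U"
  obtains e where "e \<in> extreme_points F" "\<And>\<tau>. \<tau> \<in> F \<Longrightarrow> re (\<tau> A) \<le> re (e A)"
proof -
  obtain \<sigma>1 where \<sigma>1: "\<sigma>1 \<in> F" "\<And>\<tau>. \<tau> \<in> F \<Longrightarrow> re (\<tau> A) \<le> re (\<sigma>1 A)"
    using compact_attains_re[OF F(2,3)] by blast
  define G where "G = {\<sigma>\<in>F. re (\<sigma>1 A) \<le> re (\<sigma> A)}"
  have G: "compact G" "G \<noteq> {}" "G \<subseteq> F" using compact_halfspace[OF F(2)] \<sigma>1 by (auto simp: G_def)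
  have "\<forall>k. \<exists>M\<ge>0. \<forall>\<sigma>\<in>polar sc U. norm (\<sigma> (a k)) \<le> M"
    by (intro allI, rule polar_bounded[OF U]) blast
  then obtain M where M: "\<And>k. M k \<ge> 0" "\<And>k \<sigma>. \<sigma> \<in> polar sc U \<Longrightarrow> norm (\<sigma> (a k)) \<le> M k"
    by metis
  \<comment> \<open>The weights make the series below converge uniformly on the polar, by comparison
    with a geometric series.\<close>
  define w where "w k = (1/4) ^ k / (1 + M k)\<^sup>2" for k
  have w: "w k > 0" for k using M(1)[of k] by (simp add: w_def add_pos_nonneg)
  \<comment> \<open>Stated up to \<open>2 * M k\<close> so that it also covers differences of two
    functionals.\<close>
  have bnd: "norm (w k * (norm (u))\<^sup>2) \<le> (1/4)^k * 4" if "norm u \<le> 2 * M k" for k and u :: 'k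
  proof -
    have "(norm u)\<^sup>2 \<le> (2 * (1 + M k))\<^sup>2" using that M(1)[of k] by (intro power_mono) auto
    also have "\<dots> = 4 * (1 + M k)\<^sup>2" by (simp add: power2_eq_square algebra_simps)
    finally have "w k * (norm u)\<^sup>2 \<le> w k * (4 * (1 + M k)\<^sup>2)" using w[of k] by (intro mult_left_mono) auto
    also have "\<dots> = (1/4)^k * 4" using M(1)[of k] by (simp add: w_def)
    finally show ?thesis using w[of k] by simp
  qed
  have summ: "summable (\<lambda>k. (1/4::real)^k * 4)" by (intro summable_mult2 summable_geometric) simp
  have bnd1: "norm (w k * (norm (\<sigma> (a k)))\<^sup>2) \<le> (1/4)^k * 4" if "\<sigma> \<in> polar sc U" for \<sigma> k
    using M(2)[OF that, of k] M(1)[of k] by (intro bnd) linarith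
  have bnd2: "norm (w k * (norm (f (a k) - g (a k)))\<^sup>2) \<le> (1/4)^k * 4" if "f \<in> polar sc U" "g \<in> polar sc U" for f g k
    using M(2)[OF that(1), of k] M(2)[OF that(2), of k] norm_triangle_ineq4[of "f (a k)" "g (a k)"]
    by (intro bnd) linarith
  define \<phi> where "\<phi> \<sigma> = (\<Sum>k. w k * (norm (\<sigma> (a k)))\<^sup>2)" for \<sigma> :: "'a \<Rightarrow> 'k"
  have "uniform_limit G (\<lambda>n \<sigma>. \<Sum>k<n. w k * (norm (\<sigma> (a k)))\<^sup>2) \<phi> sequentially"
    unfolding \<phi>_def using bnd1 G(3) F(4) by (intro Weierstrass_m_test[OF _ summ]) auto
  then have "continuous_on G \<phi>"
    by (rule uniform_limit_theorem[rotated])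
      (auto intro!: always_eventually continuous_on_sum continuous_on_mult continuous_on_const
        continuous_on_power continuous_on_norm continuous_on_eval)
  then obtain e where e: "e \<in> G" "\<And>\<sigma>. \<sigma> \<in> G \<Longrightarrow> \<phi> \<sigma> \<le> \<phi> e"
    using continuous_attains_sup[OF G(1,2)] by blast
  have "e \<in> extreme_points F"
  proof (rule extreme_pointsI)
    show "e \<in> F" using e G by blast
    fix f g and t :: real assume fg: "f \<in> F" "g \<in> F" and t: "0 < t" "t < 1" and eq: "e = cmb t f g"
    have rf: "re (f A) \<le> re (\<sigma>1 A)" "re (g A) \<le> re (\<sigma>1 A)" using fg \<sigma>1(2) by auto
    have re_e: "re (\<sigma>1 A) \<le> t * re (f A) + (1 - t) * re (g A)"
      using e(1) re_cmb[of t f g A] by (simp add: G_def eq)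
    have m1: "t * re (f A) \<le> t * re (\<sigma>1 A)" and m2: "(1 - t) * re (g A) \<le> (1 - t) * re (\<sigma>1 A)"
      using rf t by auto
    \<comment> \<open>A weighted average of two values not above the maximum attains it only if both
      do, so \<open>f\<close> and \<open>g\<close> belong to the face \<open>G\<close>.\<close>
    have "t * re (\<sigma>1 A) \<le> t * re (f A)" "(1 - t) * re (\<sigma>1 A) \<le> (1 - t) * re (g A)"
      using re_e m1 m2 by (auto simp: algebra_simps)
    then have "f \<in> G" "g \<in> G" using t fg by (auto simp: G_def)
    show "f = g"
    proof (rule ccontr)
      assume "f \<noteq> g"
      have P: "f \<in> polar sc U" "g \<in> polar sc U" using fg F(4) by auto
      \<comment> \<open>Continuous functions that differ somewhere differ on a nonempty open set,
        hence at a term of the dense sequence; this makes the convexity defect strictly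
        positive.\<close>
      have "open {x. f x \<noteq> g x}" using P by (intro open_Collect_neq tdual_cont polar_tdual)
      moreover have "{x. f x \<noteq> g x} \<noteq> {}" using \<open>f \<noteq> g\<close> by auto
      ultimately obtain k where k: "f (a k) \<noteq> g (a k)" using dense by blast
      let ?s = "\<lambda>\<sigma> k. w k * (norm (\<sigma> (a k)))\<^sup>2" and ?d = "\<lambda>k. w k * (norm (f (a k) - g (a k)))\<^sup>2"
      have sf: "summable (?s f)" "summable (?s g)" "summable ?d"
        using bnd1[OF P(1)] bnd1[OF P(2)] bnd2[OF P] by (auto intro: summable_comparison_test'[OF summ])
      \<comment> \<open>The identity behind strict convexity of the squared norm: the defect is
        \<open>t * (1 - t)\<close> times the squared distance of the endpoints.\<close>
      have term_eq: "?s e k = t * ?s f k + (1 - t) * ?s g k - t * (1 - t) * ?d k" for k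
      proof -
        have "e (a k) = t *\<^sub>R f (a k) + (1 - t) *\<^sub>R g (a k)"
          by (simp add: eq cmb_def scaleR_conv_of_real)
        then show ?thesis
          unfolding power2_norm_eq_inner
          by (simp only:) (simp add: inner_add_left inner_add_right inner_diff_left inner_diff_right
              inner_commute algebra_simps)
      qed
      have "\<phi> e = t * \<phi> f + (1 - t) * \<phi> g - t * (1 - t) * (\<Sum>k. ?d k)"
        unfolding \<phi>_def term_eq using sf
        by (simp add: suminf_mult summable_mult summable_add flip: suminf_add suminf_diff)
      moreover have pos: "(\<Sum>k. ?d k) > 0"
        using sf(3) w k by (intro suminf_pos2[where i = k]) (auto simp: less_imp_le)
      moreover have "t * \<phi> f \<le> t * \<phi> e" "(1 - t) * \<phi> g \<le> (1 - t) * \<phi> e"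
        using e(2) \<open>f \<in> G\<close> \<open>g \<in> G\<close> t by auto
      moreover have "t * (1 - t) * (\<Sum>k. ?d k) > 0" using t pos by simp
      ultimately have "\<phi> e < t * \<phi> e + (1 - t) * \<phi> e"
        by linarith
      then show False by (simp add: algebra_simps)
    qed
  qed
  moreover have "re (\<tau> A) \<le> re (e A)" if "\<tau> \<in> F" for \<tau>
    using \<sigma>1(2)[OF that] e(1) by (auto simp: G_def)
  ultimately show thesis using that by blast
qed

end

section \<open>The hypertopology and support functions\<close>

lemma dH_leI:
  assumes "\<And>\<sigma>. \<sigma> \<in> F \<Longrightarrow> \<exists>\<tau>\<in>G. norm (\<sigma> A - \<tau> A) \<le> r" "\<And>\<tau>. \<tau> \<in> G \<Longrightarrow> \<exists>\<sigma>\<in>F. norm (\<sigma> A - \<tau> A) \<le> r"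
  shows "dH A F G \<le> ereal r"
  unfolding dH_def
proof (intro max.boundedI SUP_least)
  fix \<sigma> assume "\<sigma> \<in> F"
  then obtain \<tau> where "\<tau> \<in> G" "norm (\<sigma> A - \<tau> A) \<le> r" using assms(1) by blast
  then show "(INF \<tau>\<in>G. ereal (norm ((\<sigma> - \<tau>) A))) \<le> ereal r" by (intro INF_lower2[of \<tau>]) auto
next
  fix \<tau> assume "\<tau> \<in> G"
  then obtain \<sigma> where "\<sigma> \<in> F" "norm (\<sigma> A - \<tau> A) \<le> r" using assms(2) by blast
  then show "(INF \<sigma>\<in>F. ereal (norm ((\<sigma> - \<tau>) A))) \<le> ereal r" by (intro INF_lower2[of \<sigma>]) auto
qed

lemma dH_lessD1:
  assumes "dH A F G < ereal r" "\<sigma> \<in> F"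
  obtains \<tau> where "\<tau> \<in> G" "norm (\<sigma> A - \<tau> A) < r"
proof -
  have "(INF \<tau>\<in>G. ereal (norm ((\<sigma> - \<tau>) A))) \<le> dH A F G"
    unfolding dH_def using assms(2) by (intro max.coboundedI1 SUP_upper)
  then have "(INF \<tau>\<in>G. ereal (norm ((\<sigma> - \<tau>) A))) < ereal r" using assms(1) by (rule le_less_trans)
  then show thesis using that by (auto simp: INF_less_iff)
qed

lemma dH_lessD2:
  assumes "dH A F G < ereal r" "\<tau> \<in> G"
  obtains \<sigma> where "\<sigma> \<in> F" "norm (\<sigma> A - \<tau> A) < r"
proof -
  have "(INF \<sigma>\<in>F. ereal (norm ((\<sigma> - \<tau>) A))) \<le> dH A F G"
    unfolding dH_def using assms(2) by (intro max.coboundedI2 SUP_upper)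
  then have "(INF \<sigma>\<in>F. ereal (norm ((\<sigma> - \<tau>) A))) < ereal r" using assms(1) by (rule le_less_trans)
  then show thesis using that by (auto simp: INF_less_iff)
qed

text \<open>The predicate defining \<open>wsH\<close> is stable under binary intersections (unite
  the index sets, take the smaller radius) and under unions, so it is the openness predicate of a
  topology.\<close>

lemma openin_wsH:
  "openin wsH W \<longleftrightarrow> (\<forall>F\<in>W. \<exists>As (\<epsilon>::real). finite As \<and> 0 < \<epsilon> \<and> {G. \<forall>A\<in>As. dH A F G < ereal \<epsilon>} \<subseteq> W)"
proof -
  let ?P = "\<lambda>W. \<forall>F\<in>W. \<exists>As (\<epsilon>::real). finite As \<and> 0 < \<epsilon> \<and> {G. \<forall>A\<in>As. dH A F G < ereal \<epsilon>} \<subseteq> W"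
  have "?P (S \<inter> T)" if S: "?P S" and T: "?P T" for S T
  proof
    fix F assume "F \<in> S \<inter> T"
    obtain As \<epsilon> where 1: "finite As" "0 < \<epsilon>" "{G. \<forall>A\<in>As. dH A F G < ereal \<epsilon>} \<subseteq> S"
      using S \<open>F \<in> S \<inter> T\<close> by blast
    obtain Bs \<delta> where 2: "finite Bs" "0 < \<delta>" "{G. \<forall>A\<in>Bs. dH A F G < ereal \<delta>} \<subseteq> T"
      using T \<open>F \<in> S \<inter> T\<close> by blast
    have "{G. \<forall>A\<in>As \<union> Bs. dH A F G < ereal (min \<epsilon> \<delta>)}
        \<subseteq> {G. \<forall>A\<in>As. dH A F G < ereal \<epsilon>} \<inter> {G. \<forall>A\<in>Bs. dH A F G < ereal \<delta>}"
      by (auto simp: min_def split: if_splits dest: less_le_trans)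
         (meson UnCI ereal_less_eq(3) less_le_trans nle_le)+
    then show "\<exists>As (\<epsilon>::real). finite As \<and> 0 < \<epsilon> \<and> {G. \<forall>A\<in>As. dH A F G < ereal \<epsilon>} \<subseteq> S \<inter> T"
      using 1 2 by (intro exI[of _ "As \<union> Bs"] exI[of _ "min \<epsilon> \<delta>"]) auto
  qed
  moreover have "?P (\<Union>K)" if K: "\<forall>S\<in>K. ?P S" for K
  proof
    fix F assume "F \<in> \<Union>K"
    then obtain S where "S \<in> K" "F \<in> S" by blast
    then obtain As \<epsilon> where "finite As" "0 < (\<epsilon>::real)" "{G. \<forall>A\<in>As. dH A F G < ereal \<epsilon>} \<subseteq> S"
      using bspec[OF bspec[OF K \<open>S \<in> K\<close>] \<open>F \<in> S\<close>] by blast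
    then show "\<exists>As (\<epsilon>::real). finite As \<and> 0 < \<epsilon> \<and> {G. \<forall>A\<in>As. dH A F G < ereal \<epsilon>} \<subseteq> \<Union>K"
      using \<open>S \<in> K\<close> by (intro exI[of _ As] exI[of _ \<epsilon>]) auto
  qed
  ultimately have "istopology ?P" unfolding istopology_def by blast
  then have "openin (topology ?P) = ?P" by (rule topology_inverse')
  then show ?thesis unfolding wsH_def by (rule fun_cong)
qed

lemma topspace_wsH [simp]: "topspace wsH = UNIV"
proof -
  have "openin wsH UNIV" unfolding openin_wsH by (auto intro!: exI[of _ "{}"] exI[of _ 1])
  then show ?thesis using openin_subset by blast
qed

context tvs_dual begin

text \<open>Real parts at \<open>A\<close> move by no more than the distance measured at
  \<open>A\<close>, so the excess of one witness over \<open>c\<close> is a sufficient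
  radius.\<close>

lemma openin_wsH_hit: "openin wsH {F. \<exists>\<sigma>\<in>F. c < re (\<sigma> A)}"
  unfolding openin_wsH
proof (intro ballI)
  fix F assume "F \<in> {F. \<exists>\<sigma>\<in>F. c < re (\<sigma> A)}"
  then obtain \<sigma> where \<sigma>: "\<sigma> \<in> F" "c < re (\<sigma> A)" by blast
  have "\<exists>\<tau>\<in>G. c < re (\<tau> A)" if G: "dH A F G < ereal (re (\<sigma> A) - c)" for G
  proof -
    obtain \<tau> where \<tau>: "\<tau> \<in> G" "norm (\<sigma> A - \<tau> A) < re (\<sigma> A) - c" using dH_lessD1[OF G \<sigma>(1)] .
    have "re (\<sigma> A) - re (\<tau> A) \<le> norm (\<sigma> A - \<tau> A)"
      using re_le_norm[of "\<sigma> A - \<tau> A"] by (simp add: inner_diff_right)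
    then show ?thesis using \<tau> by (intro bexI[of _ \<tau>]) auto
  qed
  then show "\<exists>As (\<epsilon>::real). finite As \<and> 0 < \<epsilon> \<and> {G. \<forall>A\<in>As. dH A F G < ereal \<epsilon>} \<subseteq> {F. \<exists>\<sigma>\<in>F. c < re (\<sigma> A)}"
    using \<sigma> by (intro exI[of _ "{A}"] exI[of _ "re (\<sigma> A) - c"]) auto
qed

text \<open>The intermediate bound \<open>c'\<close> leaves a positive margin, half of which absorbs
  the perturbation. A pointwise strict bound by \<open>c\<close> would leave no such margin, since
  the sets here are arbitrary.\<close>

lemma openin_wsH_below: "openin wsH {F. \<exists>c'<c. \<forall>\<sigma>\<in>F. re (\<sigma> A) \<le> c'}"
  unfolding openin_wsH
proof (intro ballI)
  fix F assume "F \<in> {F. \<exists>c'<c. \<forall>\<sigma>\<in>F. re (\<sigma> A) \<le> c'}"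
  then obtain c' where c': "c' < c" "\<And>\<sigma>. \<sigma> \<in> F \<Longrightarrow> re (\<sigma> A) \<le> c'" by blast
  have "\<exists>c'<c. \<forall>\<tau>\<in>G. re (\<tau> A) \<le> c'" if G: "dH A F G < ereal ((c - c') / 2)" for G
  proof (intro exI[of _ "(c + c') / 2"] conjI ballI)
    fix \<tau> assume "\<tau> \<in> G"
    then obtain \<sigma> where \<sigma>: "\<sigma> \<in> F" "norm (\<sigma> A - \<tau> A) < (c - c') / 2" using dH_lessD2[OF G] by blast
    have "re (\<tau> A) - re (\<sigma> A) \<le> norm (\<sigma> A - \<tau> A)"
      using re_le_norm[of "\<tau> A - \<sigma> A"] by (simp add: inner_diff_right norm_minus_commute)
    then show "re (\<tau> A) \<le> (c + c') / 2" using \<sigma>(2) c'(2)[OF \<sigma>(1)] by (simp add: field_simps)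
  qed (use c' in auto)
  then show "\<exists>As (\<epsilon>::real). finite As \<and> 0 < \<epsilon> \<and> {G. \<forall>A\<in>As. dH A F G < ereal \<epsilon>}
      \<subseteq> {F. \<exists>c'<c. \<forall>\<sigma>\<in>F. re (\<sigma> A) \<le> c'}"
    using c'(1) by (intro exI[of _ "{A}"] exI[of _ "(c - c') / 2"]) auto
qed

text \<open>Each point of \<open>K\<close> is separated from \<open>F\<close> by an evaluation. By
  compactness finitely many of the resulting half-spaces cover \<open>K\<close>, and lying below all
  their thresholds with a margin is an open condition.\<close>

lemma openin_wsH_miss:
  assumes S: "\<And>F. F \<in> S \<Longrightarrow> fconvex F \<and> compact F \<and> F \<subseteq> tdual sc"
    and K: "compact K" "K \<subseteq> tdual sc"
  shows "openin (subtopology wsH S) {F\<in>S. F \<inter> K = {}}"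
proof (subst openin_subopen, intro ballI)
  fix F assume F: "F \<in> {F\<in>S. F \<inter> K = {}}"
  have "\<exists>p c'. (\<forall>\<sigma>\<in>F. re (\<sigma> (fst p)) \<le> c') \<and> c' < snd p \<and> snd p < re (\<kappa> (fst p))" if \<kappa>: "\<kappa> \<in> K" for \<kappa>
  proof -
    obtain A c where A: "\<And>\<sigma>. \<sigma> \<in> F \<Longrightarrow> re (\<sigma> A) < c" "c < re (\<kappa> A)"
      using separation[of F \<kappa>] S[of F] F \<kappa> K by blast
    \<comment> \<open>A second threshold strictly above \<open>c\<close> gives the margin that
      \<open>openin_wsH_below\<close> requires.\<close>
    obtain c'' where "c < c''" "c'' < re (\<kappa> A)" using A(2) dense by blast
    then show ?thesis using A(1) by (intro exI[of _ "(A, c'')"] exI[of _ c]) (auto simp: less_imp_le)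
  qed
  then obtain p where p: "\<And>\<kappa>. \<kappa> \<in> K \<Longrightarrow>
      \<exists>c'. (\<forall>\<sigma>\<in>F. re (\<sigma> (fst (p \<kappa>))) \<le> c') \<and> c' < snd (p \<kappa>) \<and> snd (p \<kappa>) < re (\<kappa> (fst (p \<kappa>)))"
    by metis
  obtain E where E: "E \<subseteq> K" "finite E" "K \<subseteq> (\<Union>\<kappa>\<in>E. {\<tau>. snd (p \<kappa>) < re (\<tau> (fst (p \<kappa>)))})"
  proof (rule compactE_image[OF K(1), of K "\<lambda>\<kappa>. {\<tau>. snd (p \<kappa>) < re (\<tau> (fst (p \<kappa>)))}"])
    show "K \<subseteq> (\<Union>\<kappa>\<in>K. {\<tau>. snd (p \<kappa>) < re (\<tau> (fst (p \<kappa>)))})" using p by blast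
  qed (auto intro: open_halfspace)
  let ?N = "\<lambda>\<kappa>. {G. \<exists>c'<snd (p \<kappa>). \<forall>\<sigma>\<in>G. re (\<sigma> (fst (p \<kappa>))) \<le> c'}"
  have "openin wsH ((\<Inter>\<kappa>\<in>E. ?N \<kappa>) \<inter> topspace wsH)"
    using E(2) by (rule openin_INT) (rule openin_wsH_below)
  then have "openin wsH (\<Inter>\<kappa>\<in>E. ?N \<kappa>)" by (simp only: topspace_wsH Int_UNIV_right)
  then have "openin (subtopology wsH S) (S \<inter> (\<Inter>\<kappa>\<in>E. ?N \<kappa>))"
    by (rule openin_subtopology_Int2)
  moreover have "F \<in> S \<inter> (\<Inter>\<kappa>\<in>E. ?N \<kappa>)" using F p E(1) by blast
  moreover have "S \<inter> (\<Inter>\<kappa>\<in>E. ?N \<kappa>) \<subseteq> {F\<in>S. F \<inter> K = {}}"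
  proof
    fix G assume G: "G \<in> S \<inter> (\<Inter>\<kappa>\<in>E. ?N \<kappa>)"
    have False if \<tau>: "\<tau> \<in> G" "\<tau> \<in> K" for \<tau>
    proof -
      obtain \<kappa> where \<kappa>: "\<kappa> \<in> E" "snd (p \<kappa>) < re (\<tau> (fst (p \<kappa>)))" using E(3) \<tau>(2) by blast
      then obtain c' where "c' < snd (p \<kappa>)" "re (\<tau> (fst (p \<kappa>))) \<le> c'" using G \<tau>(1) by blast
      then show False using \<kappa>(2) by linarith
    qed
    then show "G \<in> {F\<in>S. F \<inter> K = {}}" using G by blast
  qed
  ultimately show "\<exists>T. openin (subtopology wsH S) T \<and> F \<in> T \<and> T \<subseteq> {F\<in>S. F \<inter> K = {}}" by blast
qed

lemma CU_UD:
  assumes "zero_nhd U" "F \<in> CU_U sc U"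
  shows "F \<noteq> {}" "fconvex F" "compact F" "F \<subseteq> polar sc U" "F \<subseteq> tdual sc"
  using assms CU_U_iff[OF assms(1)] polar_tdual by auto

text \<open>An evaluation that separates a point of one set from the other set yields two disjoint
  open conditions, one of hitting a half-space and one of staying below it with a margin.\<close>

lemma Hausdorff_CU_U:
  assumes U: "zero_nhd U"
  shows "Hausdorff_space (subtopology wsH (CU_U sc U))"
proof -
  let ?T = "subtopology wsH (CU_U sc U)"
  have *: "\<exists>V W. openin ?T V \<and> openin ?T W \<and> F \<in> V \<and> G \<in> W \<and> disjnt V W"
    if F: "F \<in> CU_U sc U" and G: "G \<in> CU_U sc U" and \<kappa>: "\<kappa> \<in> G" "\<kappa> \<notin> F" for F G \<kappa>
  proof -
    obtain A c where A: "\<And>\<sigma>. \<sigma> \<in> F \<Longrightarrow> re (\<sigma> A) < c" "c < re (\<kappa> A)"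
      using separation[of F \<kappa>] CU_UD[OF U F] CU_UD[OF U G] \<kappa> by blast
    obtain c'' where c'': "c < c''" "c'' < re (\<kappa> A)" using A(2) dense by blast
    let ?V = "CU_U sc U \<inter> {F. \<exists>c'<c''. \<forall>\<sigma>\<in>F. re (\<sigma> A) \<le> c'}"
    let ?W = "CU_U sc U \<inter> {F. \<exists>\<sigma>\<in>F. c'' < re (\<sigma> A)}"
    have "openin ?T ?V" "openin ?T ?W"
      by (simp_all add: openin_subtopology_Int2 openin_wsH_below openin_wsH_hit)
    moreover have "F \<in> ?V" using F A(1) c''(1) less_imp_le by blast
    moreover have "G \<in> ?W" using G \<kappa>(1) c''(2) by blast
    moreover have "disjnt ?V ?W" unfolding disjnt_iff by fastforce
    ultimately show ?thesis by blast
  qed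
  show ?thesis unfolding Hausdorff_space_def
  proof (intro allI impI)
    fix F G assume "F \<in> topspace ?T \<and> G \<in> topspace ?T \<and> F \<noteq> G"
    then have FG: "F \<in> CU_U sc U" "G \<in> CU_U sc U" "F \<noteq> G" by auto
    then consider \<kappa> where "\<kappa> \<in> G" "\<kappa> \<notin> F" | \<kappa> where "\<kappa> \<in> F" "\<kappa> \<notin> G" by blast
    then show "\<exists>V W. openin ?T V \<and> openin ?T W \<and> F \<in> V \<and> G \<in> W \<and> disjnt V W"
    proof cases
      case 1 then show ?thesis using * FG by blast
    next
      case 2
      then obtain V W where "openin ?T V" "openin ?T W" "G \<in> V" "F \<in> W" "disjnt V W"
        using *[OF FG(2,1)] by blast
      then show ?thesis using disjnt_sym[of V W] by (intro exI[of _ W] exI[of _ V] conjI)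
    qed
  qed
qed

text \<open>The support functions of the members of \<open>CU_U sc U\<close>, and the inverse of the map sending a set to
  its support function.\<close>

definition support_funs :: "'a set \<Rightarrow> ('a \<Rightarrow> real) set" where
  "support_funs U = {h. \<forall>A. \<exists>\<sigma>\<in>polar sc U. h A \<le> re (\<sigma> A) \<and> (\<forall>B. re (\<sigma> B) \<le> h B)}"

definition supported_set :: "'a set \<Rightarrow> ('a \<Rightarrow> real) \<Rightarrow> ('a \<Rightarrow> 'k) set" where
  "supported_set U h = {\<sigma>\<in>polar sc U. \<forall>B. re (\<sigma> B) \<le> h B}"

section \<open>Compactness of the hypertopology through support functions\<close>

text \<open>For fixed \<open>A\<close>, the pairs of a functional and a function \<open>h\<close>
  that satisfy the condition at \<open>A\<close> form a compact set, and so does their projection to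
  \<open>h\<close>. Intersecting over all \<open>A\<close> keeps compactness. A product of intervals
  contains every \<open>h\<close>, since each value of \<open>h\<close> is the real part of a value
  of some functional in the polar.\<close>

lemma compact_support_funs:
  assumes U: "zero_nhd U"
  shows "compact (support_funs U)"
proof -
  have "\<forall>A. \<exists>M. \<forall>\<sigma>\<in>polar sc U. norm (\<sigma> A) \<le> M"
    by (intro allI, rule polar_bounded[OF U]) blast
  then obtain M where M: "\<And>A \<sigma>. \<sigma> \<in> polar sc U \<Longrightarrow> norm (\<sigma> A) \<le> M A"
    by metis
  let ?B = "{h::'a \<Rightarrow> real. \<forall>A. h A \<in> {- M A..M A}}"
  have B: "compact ?B" by (rule compact_PiE_UNIV) simp
  let ?Z = "\<lambda>A. (polar sc U \<times> ?B) \<inter> ({z. snd z A \<le> re (fst z A)} \<inter> (\<Inter>B. {z. re (fst z B) \<le> snd z B}))"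
  have cont: "continuous_on UNIV (\<lambda>z::('a \<Rightarrow> 'k) \<times> ('a \<Rightarrow> real). re (fst z A))"
    "continuous_on UNIV (\<lambda>z::('a \<Rightarrow> 'k) \<times> ('a \<Rightarrow> real). snd z A)" for A
    by (intro continuous_on_inner continuous_on_const continuous_on_fst continuous_on_snd continuous_on_id
        continuous_on_compose2[OF continuous_on_eval, where t = UNIV] subset_UNIV)+
  have "compact (?Z A)" for A
    by (intro compact_Int_closed compact_Times B polar_compact U closed_Int closed_INT ballI
        closed_Collect_le cont)
  then have Z: "compact (snd ` ?Z A)" for A
    by (rule compact_continuous_image[OF continuous_on_snd[OF continuous_on_id]])
  have "support_funs U = (\<Inter>A. snd ` ?Z A)"
  proof (intro equalityI subsetI INT_I)
    fix h A assume h: "h \<in> support_funs U"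
    have "h B \<in> {- M B..M B}" for B
    proof -
      obtain \<sigma> where "\<sigma> \<in> polar sc U" "h B \<le> re (\<sigma> B)" "re (\<sigma> B) \<le> h B"
        using h unfolding support_funs_def by blast
      then show ?thesis using abs_re_le_norm[of "\<sigma> B"] M[of \<sigma> B] by auto
    qed
    moreover obtain \<sigma> where "\<sigma> \<in> polar sc U" "h A \<le> re (\<sigma> A)" "\<forall>B. re (\<sigma> B) \<le> h B"
      using h unfolding support_funs_def by blast
    ultimately have "(\<sigma>, h) \<in> ?Z A" by auto
    then show "h \<in> snd ` ?Z A" by (rule rev_image_eqI) simp
  next
    fix h assume h: "h \<in> (\<Inter>A. snd ` ?Z A)"
    have "\<exists>\<sigma>\<in>polar sc U. h A \<le> re (\<sigma> A) \<and> (\<forall>B. re (\<sigma> B) \<le> h B)" for A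
    proof -
      have "h \<in> snd ` ?Z A" using h by blast
      then show ?thesis by auto
    qed
    then show "h \<in> support_funs U" unfolding support_funs_def by blast
  qed
  moreover have "compact (snd ` ?Z 0 \<inter> (\<Inter>A. snd ` ?Z A))"
    by (intro compact_Int_closed Z closed_INT ballI compact_imp_closed_fun)
  moreover have "snd ` ?Z 0 \<inter> (\<Inter>A. snd ` ?Z A) = (\<Inter>A. snd ` ?Z A)" by blast
  ultimately show ?thesis by simp
qed

lemma fconvex_polar: "fconvex (polar sc U)"
proof (rule fconvexI)
  fix f g and t :: real assume f: "f \<in> polar sc U" and g: "g \<in> polar sc U" and t: "0 \<le> t" "t \<le> 1"
  have "norm (cmb t f g A) \<le> 1" if "A \<in> U" for A
  proof -
    have "norm (cmb t f g A) \<le> norm (of_real t * f A) + norm (of_real (1 - t) * g A)"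
      unfolding cmb_def by (rule norm_triangle_ineq)
    also have "\<dots> = t * norm (f A) + (1 - t) * norm (g A)"
      using t by (simp only: norm_mult norm_of_real abs_of_nonneg diff_ge_0_iff_ge)
    also have "\<dots> \<le> t * 1 + (1 - t) * 1"
      using f g t that by (intro add_mono mult_left_mono) (auto simp: polar_def)
    finally show ?thesis by simp
  qed
  then show "cmb t f g \<in> polar sc U" using f g tdual_cmb by (auto simp: polar_def)
qed

lemma supported_set_CU_U:
  assumes U: "zero_nhd U" and h: "h \<in> support_funs U"
  shows "supported_set U h \<in> CU_U sc U"
proof -
  have eq: "supported_set U h = polar sc U \<inter> (\<Inter>B. {\<sigma>. re (\<sigma> B) \<le> h B})"
    by (auto simp: supported_set_def)
  have "compact (supported_set U h)" unfolding eq
    by (intro compact_Int_closed polar_compact U closed_INT ballI closed_Collect_le continuous_re_eval continuous_on_const)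
  moreover have "fconvex (supported_set U h)"
  proof (rule fconvexI)
    fix f g and t :: real assume f: "f \<in> supported_set U h" and g: "g \<in> supported_set U h" and t: "0 \<le> t" "t \<le> 1"
    have "re (cmb t f g B) \<le> h B" for B
    proof -
      have "re (cmb t f g B) \<le> t * h B + (1 - t) * h B"
        unfolding re_cmb using f g t by (intro add_mono mult_left_mono) (auto simp: supported_set_def)
      then show ?thesis by (simp add: algebra_simps)
    qed
    then show "cmb t f g \<in> supported_set U h"
      using fconvexD[OF fconvex_polar, of f U g t] f g t by (auto simp: supported_set_def)
  qed
  moreover have "supported_set U h \<noteq> {}"
    using h unfolding support_funs_def supported_set_def by blast
  ultimately show ?thesis using CU_U_iff[OF U] by (auto simp: supported_set_def)
qed

text \<open>At \<open>A\<close> itself both inequalities in \<open>support_funs\<close> apply, so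
  \<open>h\<close> really is the support function of its set.\<close>

lemma supported_set_attains:
  assumes "h \<in> support_funs U"
  obtains \<sigma> where "\<sigma> \<in> supported_set U h" "re (\<sigma> A) = h A"
proof -
  obtain \<sigma> where "\<sigma> \<in> polar sc U" "h A \<le> re (\<sigma> A)" "\<forall>B. re (\<sigma> B) \<le> h B"
    using assms unfolding support_funs_def by blast
  then show thesis using that[of \<sigma>] by (auto simp: supported_set_def intro: antisym)
qed

text \<open>Take the support function of \<open>F\<close>; by separation it dominates no functional
  of the polar outside \<open>F\<close>.\<close>

lemma supported_set_surj:
  assumes U: "zero_nhd U" and F: "F \<in> CU_U sc U"
  obtains h where "h \<in> support_funs U" "supported_set U h = F"
proof -
  note F = CU_UD[OF U F]
  have "\<forall>A. \<exists>\<sigma>. \<sigma> \<in> F \<and> (\<forall>\<tau>\<in>F. re (\<tau> A) \<le> re (\<sigma> A))"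
    by (intro allI, rule compact_attains_re[OF F(3,1)]) blast
  then obtain s where s: "\<And>A. s A \<in> F" "\<And>A \<tau>. \<tau> \<in> F \<Longrightarrow> re (\<tau> A) \<le> re (s A A)" by metis
  define h where "h A = re (s A A)" for A
  have "h \<in> support_funs U"
    using s F(4) unfolding support_funs_def h_def by blast
  moreover have "supported_set U h = F"
  proof
    show "F \<subseteq> supported_set U h" using s F(4) by (auto simp: supported_set_def h_def)
    show "supported_set U h \<subseteq> F"
    proof (rule ccontr)
      assume "\<not> supported_set U h \<subseteq> F"
      then obtain \<tau> where \<tau>: "\<tau> \<in> polar sc U" "\<And>B. re (\<tau> B) \<le> h B" "\<tau> \<notin> F"
        by (auto simp: supported_set_def)
      obtain A c where A: "\<And>\<sigma>. \<sigma> \<in> F \<Longrightarrow> re (\<sigma> A) < c" "c < re (\<tau> A)"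
        using separation[OF F(2,3,5) polar_tdual[OF \<tau>(1)] \<tau>(3)] by blast
      then show False using \<tau>(2)[of A] s(1)[of A] unfolding h_def by (meson less_le_trans not_less_iff_gr_or_eq)
    qed
  qed
  ultimately show thesis using that by blast
qed

text \<open>The values at \<open>A\<close> form a compact convex set of scalars. Projecting the
  value of \<sigma> onto it and rotating the normal direction onto the real axis turns a distance in
  modulus into a gap between real parts, which support functions can detect.\<close>

lemma directional_gap:
  assumes G: "fconvex G" "compact G" "G \<noteq> {}" "G \<subseteq> tdual sc" and \<sigma>: "\<sigma> \<in> tdual sc"
    and r: "r > 0" "\<forall>\<tau>\<in>G. r \<le> norm (\<sigma> A - \<tau> A)"
  obtains z where "norm z = 1" "\<And>\<tau>. \<tau> \<in> G \<Longrightarrow> re (\<tau> (sc z A)) + r \<le> re (\<sigma> (sc z A))"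
proof -
  let ?T = "(\<lambda>\<tau>. \<tau> A) ` G"
  have "compact ?T" by (rule compact_continuous_image[OF continuous_on_eval G(2)])
  then have "closed ?T" by (rule compact_imp_closed)
  have "convex ?T"
  proof (rule convexI)
    fix x y and u v :: real assume "x \<in> ?T" "y \<in> ?T" and uv: "0 \<le> u" "0 \<le> v" "u + v = 1"
    then obtain f g where fg: "f \<in> G" "g \<in> G" "x = f A" "y = g A" by blast
    have "v = 1 - u" using uv by simp
    then have "u *\<^sub>R x + v *\<^sub>R y = cmb u f g A" using fg by (simp add: cmb_def scaleR_conv_of_real)
    moreover have "cmb u f g \<in> G" using fg uv by (intro fconvexD[OF G(1)]) auto
    ultimately show "u *\<^sub>R x + v *\<^sub>R y \<in> ?T" by blast
  qed
  obtain x where x: "x \<in> ?T" "\<And>y. y \<in> ?T \<Longrightarrow> dist (\<sigma> A) x \<le> dist (\<sigma> A) y"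
    using distance_attains_inf[OF \<open>closed ?T\<close>, of "\<sigma> A"] G(3) by blast
  define d where "d = \<sigma> A - x"
  have dr: "r \<le> norm d" using x(1) r(2) by (auto simp: d_def)
  \<comment> \<open>With this unit scalar, the real part of \<open>z * w\<close> is the component of
    \<open>w\<close> along \<open>d\<close>.\<close>
  define z where "z = of_real (1 / norm d) * cj d"
  have "norm z = 1" using dr r(1) by (auto simp: z_def norm_mult norm_cj norm_divide)
  moreover have "re (\<tau> (sc z A)) + r \<le> re (\<sigma> (sc z A))" if "\<tau> \<in> G" for \<tau>
  proof -
    have "d \<bullet> (\<tau> A - x) \<le> 0" unfolding d_def
      using \<open>convex ?T\<close> \<open>closed ?T\<close> x that by (intro any_closest_point_dot) auto
    moreover have "d \<bullet> (\<sigma> A - \<tau> A) = d \<bullet> d - d \<bullet> (\<tau> A - x)"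
      by (simp add: d_def inner_diff_right)
    ultimately have "norm d * norm d \<le> d \<bullet> (\<sigma> A - \<tau> A)" by (simp add: norm_eq_sqrt_inner)
    also have "\<dots> = re (cj d * (\<sigma> A - \<tau> A))" by (rule inner_cj)
    finally have "norm d \<le> re (cj d * (\<sigma> A - \<tau> A)) / norm d"
      using dr r(1) by (subst pos_le_divide_eq) auto
    also have "\<dots> = 1 / norm d * re (cj d * (\<sigma> A - \<tau> A))" by simp
    also have "\<dots> = re (z * (\<sigma> A - \<tau> A))" unfolding z_def mult.assoc re_of_real_mult ..
    also have "\<dots> = re (\<sigma> (sc z A)) - re (\<tau> (sc z A))"
      using that G(4) \<sigma> by (simp add: subset_iff tdual_scale right_diff_distrib inner_diff_right)
    finally show ?thesis using dr by linarith
  qed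
  ultimately show thesis using that by blast
qed

text \<open>If \<sigma> were at distance at least \<open>r\<close> from the second set,
  \<open>directional_gap\<close> would give a gap \<open>r\<close> in some direction. Passing to a
  net direction costs at most \<open>r/4\<close> for each of two functionals, and exchanging
  \<open>h\<close> for \<open>h'\<close> costs less than \<open>r/4\<close>, in total less than
  \<open>r\<close>.\<close>

lemma supported_set_near:
  assumes h: "h \<in> support_funs U" and h': "h' \<in> support_funs U" and U: "zero_nhd U"
    and M: "\<forall>\<sigma>\<in>polar sc U. norm (\<sigma> A) \<le> M" and r: "r > 0"
    and Z: "\<forall>z. norm z = 1 \<longrightarrow> (\<exists>z'\<in>Z. norm (z - z') * M \<le> r / 4)"
    and near: "\<forall>z'\<in>Z. \<bar>h (sc z' A) - h' (sc z' A)\<bar> < r / 4"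
    and \<sigma>: "\<sigma> \<in> supported_set U h"
  shows "\<exists>\<tau>\<in>supported_set U h'. norm (\<sigma> A - \<tau> A) \<le> r"
proof (rule ccontr)
  assume "\<not> (\<exists>\<tau>\<in>supported_set U h'. norm (\<sigma> A - \<tau> A) \<le> r)"
  then have far: "\<forall>\<tau>\<in>supported_set U h'. r \<le> norm (\<sigma> A - \<tau> A)" by force
  note G = CU_UD[OF U supported_set_CU_U[OF U h']]
  have \<sigma>P: "\<sigma> \<in> polar sc U" using \<sigma> by (simp add: supported_set_def)
  obtain z where z: "norm z = 1" "\<And>\<tau>. \<tau> \<in> supported_set U h' \<Longrightarrow> re (\<tau> (sc z A)) + r \<le> re (\<sigma> (sc z A))"
    using directional_gap[OF G(2,3,1,5) polar_tdual[OF \<sigma>P] r far] by blast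
  obtain z' where z': "z' \<in> Z" "norm (z - z') * M \<le> r / 4" using Z z(1) by blast
  obtain \<tau> where \<tau>: "\<tau> \<in> supported_set U h'" "re (\<tau> (sc z' A)) = h' (sc z' A)"
    using supported_set_attains[OF h'] by blast
  have \<tau>P: "\<tau> \<in> polar sc U" using \<tau> by (simp add: supported_set_def)
  have close: "\<bar>re (\<omega> (sc z A)) - re (\<omega> (sc z' A))\<bar> \<le> r / 4" if "\<omega> \<in> polar sc U" for \<omega>
  proof -
    have "re (\<omega> (sc z A)) - re (\<omega> (sc z' A)) = re ((z - z') * \<omega> A)"
      using that by (simp add: tdual_scale polar_tdual left_diff_distrib inner_diff_right)
    also have "\<bar>\<dots>\<bar> \<le> norm (z - z') * norm (\<omega> A)"
      using abs_re_le_norm[of "(z - z') * \<omega> A"] by (simp add: norm_mult)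
    also have "\<dots> \<le> norm (z - z') * M" using M that by (intro mult_left_mono) auto
    finally show ?thesis using z'(2) by linarith
  qed
  have "re (\<sigma> (sc z' A)) \<le> h (sc z' A)" using \<sigma> by (simp add: supported_set_def)
  then show False
    using z(2)[OF \<tau>(1)] \<tau>(2) bspec[OF near z'(1)] close[OF \<sigma>P] close[OF \<tau>P] r
    by (auto simp: abs_le_iff abs_less_iff)
qed

text \<open>The unit scalars form a compact sphere, so closeness of the support functions at
  finitely many rotations of \<open>A\<close> controls the pseudometric at \<open>A\<close>.\<close>

lemma supported_set_continuous_dH:
  assumes U: "zero_nhd U" and h: "h \<in> support_funs U" and e: "(e::real) > 0"
  obtains N where "open N" "h \<in> N" "\<And>h'. h' \<in> support_funs U \<Longrightarrow> h' \<in> N \<Longrightarrow> dH A (supported_set U h) (supported_set U h') < ereal e"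
proof -
  obtain M where M: "\<forall>\<sigma>\<in>polar sc U. norm (\<sigma> A) \<le> M" "M \<ge> 0"
    by (rule polar_bounded[OF U])
  \<comment> \<open>\<open>M + 1\<close> keeps the denominator positive; \<open>r = e / 2\<close>
    turns a bound by \<open>r\<close> into a strict bound by \<open>e\<close>.\<close>
  define r \<rho> where "r = e / 2" and "\<rho> = r / (4 * (M + 1))"
  have r: "r > 0" "\<rho> > 0" using e M(2) by (auto simp: r_def \<rho>_def)
  have "compact (sphere (0::'k) 1)" by (rule compact_sphere)
  then obtain Z where Z: "Z \<subseteq> sphere (0::'k) 1" "finite Z" "sphere (0::'k) 1 \<subseteq> (\<Union>z\<in>Z. ball z \<rho>)"
    by (rule compactE_image[of _ "sphere (0::'k) 1" "\<lambda>z. ball z \<rho>"]) (use r in auto)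
  have net: "\<forall>z. norm z = 1 \<longrightarrow> (\<exists>z'\<in>Z. norm (z - z') * M \<le> r / 4)"
  proof (intro allI impI)
    fix z :: 'k assume "norm z = 1"
    obtain z' where z': "z' \<in> Z" "norm (z - z') < \<rho>"
      using Z(3) \<open>norm z = 1\<close> by (force simp: dist_norm norm_minus_commute)
    have "norm (z - z') * M \<le> \<rho> * (M + 1)" using z'(2) M(2) r by (intro mult_mono) auto
    also have "\<dots> = r / 4" using M(2) by (simp add: \<rho>_def field_simps)
    finally show "\<exists>z'\<in>Z. norm (z - z') * M \<le> r / 4" using z'(1) by blast
  qed
  define N where "N = (\<Inter>z\<in>Z. {h'. \<bar>h (sc z A) - h' (sc z A)\<bar> < r / 4})"
  have "open N" unfolding N_def
    by (intro open_INT Z ballI open_Collect_less continuous_on_const continuous_on_rabs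
        continuous_on_diff continuous_on_eval)
  moreover have "h \<in> N" using r by (simp add: N_def)
  moreover have "dH A (supported_set U h) (supported_set U h') < ereal e" if h': "h' \<in> support_funs U" "h' \<in> N" for h'
  proof -
    have near: "\<forall>z\<in>Z. \<bar>h (sc z A) - h' (sc z A)\<bar> < r / 4" "\<forall>z\<in>Z. \<bar>h' (sc z A) - h (sc z A)\<bar> < r / 4"
      using h'(2) by (auto simp: N_def abs_minus_commute)
    have "dH A (supported_set U h) (supported_set U h') \<le> ereal r"
    proof (rule dH_leI)
      fix \<sigma> assume "\<sigma> \<in> supported_set U h"
      then show "\<exists>\<tau>\<in>supported_set U h'. norm (\<sigma> A - \<tau> A) \<le> r"
        by (rule supported_set_near[OF h h'(1) U M(1) r(1) net near(1)])
    next
      fix \<tau> assume "\<tau> \<in> supported_set U h'"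
      then have "\<exists>\<sigma>\<in>supported_set U h. norm (\<tau> A - \<sigma> A) \<le> r"
        by (rule supported_set_near[OF h'(1) h U M(1) r(1) net near(2)])
      then show "\<exists>\<sigma>\<in>supported_set U h. norm (\<sigma> A - \<tau> A) \<le> r" by (simp add: norm_minus_commute)
    qed
    also have "\<dots> < ereal e" using e by (simp add: r_def)
    finally show ?thesis .
  qed
  ultimately show thesis using that by blast
qed

text \<open>The map \<open>supported_set U\<close> is continuous on the compact set of support
  functions, and its image is \<open>CU_U sc U\<close>.\<close>

lemma compact_space_CU_U:
  assumes U: "zero_nhd U"
  shows "compact_space (subtopology wsH (CU_U sc U))"
proof -
  let ?S = "support_funs U" and ?\<Phi> = "supported_set U"
  have "continuous_map (top_of_set ?S) wsH ?\<Phi>"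
    unfolding continuous_map_def
  proof (intro conjI allI impI)
    fix W :: "('a \<Rightarrow> 'k) set set" assume W: "openin wsH W"
    show "openin (top_of_set ?S) {h \<in> topspace (top_of_set ?S). ?\<Phi> h \<in> W}"
    proof (subst openin_subopen, intro ballI)
      fix h assume "h \<in> {h \<in> topspace (top_of_set ?S). ?\<Phi> h \<in> W}"
      then have h: "h \<in> ?S" "?\<Phi> h \<in> W" by auto
      obtain As \<epsilon> where As: "finite As" "0 < (\<epsilon>::real)" "{G. \<forall>A\<in>As. dH A (?\<Phi> h) G < ereal \<epsilon>} \<subseteq> W"
        using W h(2) unfolding openin_wsH by blast
      have "\<forall>A. \<exists>N. open N \<and> h \<in> N \<and> (\<forall>h'\<in>?S \<inter> N. dH A (?\<Phi> h) (?\<Phi> h') < ereal \<epsilon>)"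
        by (intro allI, rule supported_set_continuous_dH[OF U h(1) As(2)]) blast
      then obtain N where N: "\<And>A. open (N A)" "\<And>A. h \<in> N A" "\<And>A h'. h' \<in> ?S \<Longrightarrow> h' \<in> N A \<Longrightarrow> dH A (?\<Phi> h) (?\<Phi> h') < ereal \<epsilon>"
        by (metis IntI)
      have "openin (top_of_set ?S) (?S \<inter> (\<Inter>A\<in>As. N A))"
        using As(1) N(1) by (intro openin_open_Int open_INT) auto
      moreover have "h \<in> ?S \<inter> (\<Inter>A\<in>As. N A)" using h N by blast
      moreover have "?S \<inter> (\<Inter>A\<in>As. N A) \<subseteq> {h \<in> topspace (top_of_set ?S). ?\<Phi> h \<in> W}"
        using N(3) As(3) by fastforce
      ultimately show "\<exists>T. openin (top_of_set ?S) T \<and> h \<in> T \<and> T \<subseteq> {h \<in> topspace (top_of_set ?S). ?\<Phi> h \<in> W}"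
        by blast
    qed
  qed auto
  moreover have "compactin (top_of_set ?S) ?S"
    using compact_support_funs[OF U] by (simp add: compactin_subtopology)
  ultimately have "compactin wsH (?\<Phi> ` ?S)" by (rule image_compactin[rotated])
  moreover have "?\<Phi> ` ?S = CU_U sc U"
  proof
    show "?\<Phi> ` ?S \<subseteq> CU_U sc U" using supported_set_CU_U[OF U] by blast
    show "CU_U sc U \<subseteq> ?\<Phi> ` ?S"
    proof
      fix F assume "F \<in> CU_U sc U"
      then obtain h where "h \<in> ?S" "?\<Phi> h = F" by (rule supported_set_surj[OF U])
      then show "F \<in> ?\<Phi> ` ?S" by blast
    qed
  qed
  ultimately show ?thesis by (simp add: compact_space_subtopology)
qed

end

section \<open>Density of extreme points as a countable intersection\<close>

definition eval_dist :: "'a set \<Rightarrow> ('a \<Rightarrow> 'k::real_normed_field) \<Rightarrow> ('a \<Rightarrow> 'k) \<Rightarrow> real" where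
  "eval_dist B \<sigma> \<tau> = (\<Sum>b\<in>B. norm (\<sigma> b - \<tau> b))"

lemma eval_dist_self [simp]: "eval_dist B \<sigma> \<sigma> = 0"
  by (simp add: eval_dist_def)

lemma eval_dist_commute: "eval_dist B \<sigma> \<tau> = eval_dist B \<tau> \<sigma>"
  by (simp add: eval_dist_def norm_minus_commute)

lemma eval_dist_triangle: "eval_dist B \<sigma> \<omega> \<le> eval_dist B \<sigma> \<tau> + eval_dist B \<tau> \<omega>"
  unfolding eval_dist_def sum.distrib[symmetric]
  by (rule sum_mono) (metis diff_add_cancel add_diff_eq norm_triangle_ineq)

lemma norm_le_eval_dist: "finite B \<Longrightarrow> b \<in> B \<Longrightarrow> norm (\<sigma> b - \<tau> b) \<le> eval_dist B \<sigma> \<tau>"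
  unfolding eval_dist_def by (rule member_le_sum) auto

lemma eval_dist_mono: "finite B' \<Longrightarrow> B \<subseteq> B' \<Longrightarrow> eval_dist B \<sigma> \<tau> \<le> eval_dist B' \<sigma> \<tau>"
  unfolding eval_dist_def by (rule sum_mono2) auto

lemma continuous_on_eval_dist: "continuous_on S (\<lambda>\<tau>. eval_dist B \<tau> \<sigma>)"
  unfolding eval_dist_def
  by (intro continuous_on_sum continuous_on_norm continuous_on_diff continuous_on_eval continuous_on_const)

lemma open_eval_dist: "open {\<tau>. eval_dist B \<tau> \<sigma> < e}"
  by (intro open_Collect_less continuous_on_eval_dist continuous_on_const)

lemma eval_dist_cmb_less:
  assumes "eval_dist B f f' < e" "eval_dist B g g' < e" "0 \<le> t" "t \<le> 1"
  shows "eval_dist B (cmb t f g) (cmb t f' g') < e"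
proof -
  have "eval_dist B (cmb t f g) (cmb t f' g') \<le> t * eval_dist B f f' + (1 - t) * eval_dist B g g'"
    unfolding eval_dist_def sum_distrib_left sum.distrib[symmetric]
  proof (rule sum_mono)
    fix b
    have "cmb t f g b - cmb t f' g' b = of_real t * (f b - f' b) + of_real (1 - t) * (g b - g' b)"
      by (simp add: cmb_def algebra_simps)
    also have "norm \<dots> \<le> norm (of_real t * (f b - f' b)) + norm (of_real (1 - t) * (g b - g' b))"
      by (rule norm_triangle_ineq)
    also have "\<dots> = t * norm (f b - f' b) + (1 - t) * norm (g b - g' b)"
      using assms(3,4) by (simp only: norm_mult norm_of_real abs_of_nonneg diff_ge_0_iff_ge)
    finally show "norm (cmb t f g b - cmb t f' g' b) \<le> t * norm (f b - f' b) + (1 - t) * norm (g b - g' b)" .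
  qed
  also have "\<dots> < e" using assms by (intro convex_bound_lt) auto
  finally show ?thesis .
qed

section \<open>Linear independence of functions and extreme points of joins\<close>

text \<open>Makes the scalar functions a vector space over \<open>'k\<close> itself, so that span
  and dependence use all scalars as coefficients and not only real ones.\<close>

definition fscale :: "'k::field \<Rightarrow> ('a \<Rightarrow> 'k) \<Rightarrow> 'a \<Rightarrow> 'k" where
  "fscale c f = (\<lambda>x. c * f x)"

interpretation fvs: Vector_Spaces.vector_space fscale
  by unfold_locales (auto simp: fscale_def fun_eq_iff algebra_simps)

lemma sum_fun_apply: "(\<Sum>i\<in>I. f i) x = (\<Sum>i\<in>I. f i x)" for f :: "'i \<Rightarrow> 'a \<Rightarrow> 'k::comm_monoid_add"
  by (induction I rule: infinite_finite_induct) auto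

lemma cmb_eq_fscale: "cmb t f g = fscale (of_real t) f + fscale (of_real (1 - t)) g"
  by (auto simp: cmb_def fscale_def)

lemma cmb_in_span: "f \<in> fvs.span T \<Longrightarrow> g \<in> fvs.span T \<Longrightarrow> cmb t f g \<in> fvs.span T"
  unfolding cmb_eq_fscale by (intro fvs.span_add fvs.span_scale)

text \<open>Otherwise dividing by \<open>c\<close> would express \<open>h\<close> through
  \<open>T\<close>.\<close>

lemma coefficient_zero:
  assumes "h \<notin> fvs.span T" "p \<in> fvs.span T" "\<And>x. c * h x = p x"
  shows "c = 0"
proof (rule ccontr)
  assume "c \<noteq> 0"
  then have "h = fscale (1 / c) p" using assms(3)[symmetric] by (simp add: fscale_def fun_eq_iff)
  then show False using assms(1,2) by (auto intro: fvs.span_scale)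
qed

text \<open>As \<open>h\<close> lies outside the span that contains \<open>G\<close>, the total
  weight \<open>?w\<close> that a combination puts on \<open>h\<close> is determined by its value.
  For a value in \<open>G\<close> this weight is 0, so both endpoints lie in
  \<open>G\<close>.\<close>

lemma extreme_points_join_left:
  assumes G: "G \<subseteq> fvs.span T" and h: "h \<notin> fvs.span T" and e: "e \<in> extreme_points G"
  shows "e \<in> extreme_points (join G {h})"
proof (rule extreme_pointsI)
  have eG: "e \<in> G" using e extreme_points_subset by blast
  then show "e \<in> join G {h}" using join_superset1[of "{h}" G] by blast
  fix f k and t :: real
  assume fk: "f \<in> join G {h}" "k \<in> join G {h}" and t: "0 < t" "t < 1" "e = cmb t f k"
  obtain a c b c' where f: "f = cmb a c h" "c \<in> G" "0 \<le> a" "a \<le> 1"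
    and k: "k = cmb b c' h" "c' \<in> G" "0 \<le> b" "b \<le> 1"
    using fk unfolding join_def by blast
  let ?w = "t * (1 - a) + (1 - t) * (1 - b)"
  have "of_real ?w = (0::'b)"
  proof (rule coefficient_zero[OF h])
    show "e - fscale (of_real (t * a)) c - fscale (of_real ((1 - t) * b)) c' \<in> fvs.span T"
      using G eG f(2) k(2) by (intro fvs.span_diff fvs.span_scale) auto
    show "of_real ?w * h x = (e - fscale (of_real (t * a)) c - fscale (of_real ((1 - t) * b)) c') x" for x
      by (simp add: t(3) f(1) k(1) cmb_def fscale_def algebra_simps)
  qed
  then have "?w = 0" by (simp only: of_real_eq_0_iff)
  moreover have "t * (1 - a) \<ge> 0" "(1 - t) * (1 - b) \<ge> 0" using t f k by auto
  ultimately have "t * (1 - a) = 0" "(1 - t) * (1 - b) = 0" by linarith+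
  then have "a = 1" "b = 1" using t by auto
  then have "f = c" "k = c'" using f k by auto
  then show "f = k" using extreme_pointsD[OF e, of f k t] f(2) k(2) t by blast
qed

text \<open>The same comparison of coefficients, now for the weight \<open>?w\<close> put on
  \<open>G\<close>, which vanishes when the combination equals \<open>h\<close>.\<close>

lemma extreme_points_join_right:
  assumes G: "G \<subseteq> fvs.span T" "G \<noteq> {}" and h: "h \<notin> fvs.span T"
  shows "h \<in> extreme_points (join G {h})"
proof (rule extreme_pointsI)
  show "h \<in> join G {h}" using join_superset2[OF G(2), of "{h}"] by blast
  fix f k and t :: real
  assume fk: "f \<in> join G {h}" "k \<in> join G {h}" and t: "0 < t" "t < 1" "h = cmb t f k"
  obtain a c b c' where f: "f = cmb a c h" "c \<in> G" "0 \<le> a" "a \<le> 1"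
    and k: "k = cmb b c' h" "c' \<in> G" "0 \<le> b" "b \<le> 1"
    using fk unfolding join_def by blast
  let ?w = "t * a + (1 - t) * b"
  have "of_real ?w = (0::'b)"
  proof (rule coefficient_zero[OF h])
    show "fscale (of_real (t * a)) c + fscale (of_real ((1 - t) * b)) c' \<in> fvs.span T"
      using G f(2) k(2) by (intro fvs.span_add fvs.span_scale) auto
    fix x
    have "h x = of_real t * (of_real a * c x + of_real (1 - a) * h x)
        + of_real (1 - t) * (of_real b * c' x + of_real (1 - b) * h x)"
      using fun_cong[OF t(3), of x] unfolding f(1) k(1) cmb_def .
    then show "of_real ?w * h x = (fscale (of_real (t * a)) c + fscale (of_real ((1 - t) * b)) c') x"
      by (simp add: fscale_def algebra_simps)
  qed
  then have "?w = 0" by (simp only: of_real_eq_0_iff)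
  moreover have "t * a \<ge> 0" "(1 - t) * b \<ge> 0" using t f k by auto
  ultimately have "t * a = 0" "(1 - t) * b = 0" by linarith+
  then have "a = 0" "b = 0" using t by auto
  then show "f = k" using f k by simp
qed

section \<open>Open conditions that characterise density of the extreme points\<close>

context tvs_dual begin

text \<open>The slice is closed while the witness lies strictly inside it. In a compact
  \<open>F\<close> the slice is then compact, which yields a uniform margin below \<open>e\<close>,
  and both requirements persist for nearby sets.\<close>

definition near_extreme :: "'a set \<Rightarrow> real \<Rightarrow> ('a \<Rightarrow> 'k) set set" where
  "near_extreme B e = {F. \<forall>\<sigma>\<in>F. \<exists>A c. (\<exists>\<tau>\<in>F. c < re (\<tau> A)) \<and> (\<forall>\<tau>\<in>F. c \<le> re (\<tau> A) \<longrightarrow> eval_dist B \<tau> \<sigma> < e)}"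

text \<open>After a finite cover of \<open>F\<close> by small balls, three open conditions on a set
  \<open>G\<close> suffice: it stays within the balls, it meets each chosen open half-space, and it
  has no far points in the chosen closed slices.\<close>

lemma openin_near_extreme:
  assumes U: "zero_nhd U"
  shows "openin (subtopology wsH (CU_U sc U)) (CU_U sc U \<inter> near_extreme B e)"
proof (subst openin_subopen, intro ballI)
  let ?T = "subtopology wsH (CU_U sc U)"
  fix F assume F: "F \<in> CU_U sc U \<inter> near_extreme B e"
  note FU = CU_UD[OF U IntD1[OF F]]
  have "\<exists>A c r. r > 0 \<and> (\<exists>\<tau>\<in>F. c < re (\<tau> A)) \<and> (\<forall>\<tau>\<in>F. c \<le> re (\<tau> A) \<longrightarrow> eval_dist B \<tau> \<sigma> < e - r)"
    if \<sigma>: "\<sigma> \<in> F" for \<sigma>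
  proof -
    obtain A c \<tau>0 where A: "\<tau>0 \<in> F" "c < re (\<tau>0 A)" "\<forall>\<tau>\<in>F. c \<le> re (\<tau> A) \<longrightarrow> eval_dist B \<tau> \<sigma> < e"
      using F \<sigma> unfolding near_extreme_def by blast
    let ?S = "{\<tau>\<in>F. c \<le> re (\<tau> A)}"
    have "?S \<noteq> {}" using A(1,2) less_imp_le by blast
    then obtain \<tau>1 where \<tau>1: "\<tau>1 \<in> ?S" "\<forall>\<tau>\<in>?S. eval_dist B \<tau> \<sigma> \<le> eval_dist B \<tau>1 \<sigma>"
      using continuous_attains_sup[OF compact_halfspace[OF FU(3)] _ continuous_on_eval_dist] by blast
    \<comment> \<open>Half of the gap left by the farthest point of the slice, so that the bound
      remains strict after \<open>?r\<close> is subtracted.\<close>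
    let ?r = "(e - eval_dist B \<tau>1 \<sigma>) / 2"
    have r: "?r > 0" "eval_dist B \<tau>1 \<sigma> < e - ?r" using A(3) \<tau>1(1) by (auto simp: field_simps)
    then have "\<forall>\<tau>\<in>F. c \<le> re (\<tau> A) \<longrightarrow> eval_dist B \<tau> \<sigma> < e - ?r" using \<tau>1(2) by fastforce
    then show ?thesis using r(1) A(1,2) by blast
  qed
  then obtain A c r where p: "\<And>\<sigma>. \<sigma> \<in> F \<Longrightarrow> r \<sigma> > 0 \<and> (\<exists>\<tau>\<in>F. c \<sigma> < re (\<tau> (A \<sigma>)))
      \<and> (\<forall>\<tau>\<in>F. c \<sigma> \<le> re (\<tau> (A \<sigma>)) \<longrightarrow> eval_dist B \<tau> \<sigma> < e - r \<sigma>)"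
    by metis
  obtain E where E: "E \<subseteq> F" "finite E" "F \<subseteq> (\<Union>\<sigma>\<in>E. {\<tau>. eval_dist B \<tau> \<sigma> < r \<sigma>})"
  proof (rule compactE_image[OF FU(3), of F "\<lambda>\<sigma>. {\<tau>. eval_dist B \<tau> \<sigma> < r \<sigma>}"])
    show "F \<subseteq> (\<Union>\<sigma>\<in>F. {\<tau>. eval_dist B \<tau> \<sigma> < r \<sigma>})" using p by fastforce
  qed (auto intro: open_eval_dist)
  \<comment> \<open>\<open>L\<close> collects the functionals of the polar outside all chosen balls,
    \<open>K\<close> those in a slice but too far from its reference point. Missing these compact
    sets is an open condition.\<close>
  define L where "L = polar sc U \<inter> (\<Inter>\<sigma>\<in>E. {\<tau>. r \<sigma> \<le> eval_dist B \<tau> \<sigma>})"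
  define K where "K \<sigma> = polar sc U \<inter> ({\<tau>. c \<sigma> \<le> re (\<tau> (A \<sigma>))} \<inter> {\<tau>. e - r \<sigma> \<le> eval_dist B \<tau> \<sigma>})" for \<sigma>
  have closed: "closed {\<tau>. s \<le> eval_dist B \<tau> \<sigma>}" for s \<sigma>
    by (intro closed_Collect_le continuous_on_const continuous_on_eval_dist)
  have "compact L" unfolding L_def
    by (intro compact_Int_closed polar_compact U closed_INT ballI closed)
  moreover have "compact (K \<sigma>)" for \<sigma> unfolding K_def
    by (intro compact_Int_closed polar_compact U closed_Int closed closed_halfspace)
  ultimately have cpt: "compact (L \<union> (\<Union>\<sigma>\<in>E. K \<sigma>))"
    using E(2) by (intro compact_Un compact_UN) auto
  have sub: "L \<union> (\<Union>\<sigma>\<in>E. K \<sigma>) \<subseteq> tdual sc" using polar_tdual by (auto simp: L_def K_def)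
  let ?M = "{G\<in>CU_U sc U. G \<inter> (L \<union> (\<Union>\<sigma>\<in>E. K \<sigma>)) = {}}"
  have "openin ?T ?M"
    by (rule openin_wsH_miss[OF _ cpt sub]) (simp add: CU_UD[OF U])
  moreover have "openin wsH ((\<Inter>\<sigma>\<in>E. {G. \<exists>\<tau>\<in>G. c \<sigma> < re (\<tau> (A \<sigma>))}) \<inter> topspace wsH)"
    using E(2) by (rule openin_INT) (rule openin_wsH_hit)
  then have "openin wsH (\<Inter>\<sigma>\<in>E. {G. \<exists>\<tau>\<in>G. c \<sigma> < re (\<tau> (A \<sigma>))})"
    by (simp only: topspace_wsH Int_UNIV_right)
  then have "openin ?T (CU_U sc U \<inter> (\<Inter>\<sigma>\<in>E. {G. \<exists>\<tau>\<in>G. c \<sigma> < re (\<tau> (A \<sigma>))}))"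
    by (rule openin_subtopology_Int2)
  ultimately have "openin ?T (?M \<inter> (CU_U sc U \<inter> (\<Inter>\<sigma>\<in>E. {G. \<exists>\<tau>\<in>G. c \<sigma> < re (\<tau> (A \<sigma>))})))" (is "openin ?T ?N")
    by (rule openin_Int)
  moreover have "F \<in> ?N"
  proof -
    have "F \<inter> L = {}" using E(3) by (fastforce simp: L_def)
    moreover have "F \<inter> K \<sigma> = {}" if "\<sigma> \<in> E" for \<sigma>
      using p[of \<sigma>] E(1) that by (fastforce simp: K_def)
    ultimately show ?thesis using F p E(1) by blast
  qed
  moreover have "?N \<subseteq> CU_U sc U \<inter> near_extreme B e"
  proof
    fix G assume G: "G \<in> ?N"
    then have GP: "G \<subseteq> polar sc U" using CU_UD(4)[OF U] by blast
    have "\<exists>A c. (\<exists>\<tau>\<in>G. c < re (\<tau> A)) \<and> (\<forall>\<tau>\<in>G. c \<le> re (\<tau> A) \<longrightarrow> eval_dist B \<tau> \<sigma> < e)" if \<sigma>: "\<sigma> \<in> G" for \<sigma>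
    proof -
      have "\<sigma> \<notin> L" using G \<sigma> by blast
      then obtain \<omega> where \<omega>: "\<omega> \<in> E" "eval_dist B \<sigma> \<omega> < r \<omega>" using GP \<sigma> by (auto simp: L_def not_le)
      have "\<exists>\<tau>\<in>G. c \<omega> < re (\<tau> (A \<omega>))" using G \<omega>(1) by blast
      moreover have "eval_dist B \<tau> \<sigma> < e" if \<tau>: "\<tau> \<in> G" "c \<omega> \<le> re (\<tau> (A \<omega>))" for \<tau>
      proof -
        have "\<tau> \<notin> K \<omega>" using G \<tau>(1) \<omega>(1) by blast
        then have "eval_dist B \<tau> \<omega> < e - r \<omega>" using GP \<tau> by (auto simp: K_def not_le)
        then show ?thesis
          using eval_dist_triangle[of B \<tau> \<sigma> \<omega>] \<omega>(2) eval_dist_commute[of B \<sigma> \<omega>] by linarith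
      qed
      ultimately show ?thesis by blast
    qed
    then show "G \<in> CU_U sc U \<inter> near_extreme B e" using G by (auto simp: near_extreme_def)
  qed
  ultimately show "\<exists>T. openin ?T T \<and> F \<in> T \<and> T \<subseteq> CU_U sc U \<inter> near_extreme B e" by blast
qed

text \<open>Take an extreme point within \<open>e/2\<close> of the given point, and around it a
  slice of radius \<open>e/2\<close>.\<close>

lemma closure_extreme_imp_near_extreme:
  assumes U: "zero_nhd U" and F: "F \<in> CU_U sc U" and cl: "F \<subseteq> closure (extreme_points F)" and e: "e > 0"
  shows "F \<in> near_extreme B e"
  unfolding near_extreme_def
proof (intro CollectI ballI)
  fix \<sigma> assume "\<sigma> \<in> F"
  note FU = CU_UD[OF U F]
  have "\<sigma> \<in> {\<tau>. eval_dist B \<tau> \<sigma> < e / 2} \<inter> closure (extreme_points F)"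
    using cl \<open>\<sigma> \<in> F\<close> e by auto
  then have "{\<tau>. eval_dist B \<tau> \<sigma> < e / 2} \<inter> extreme_points F \<noteq> {}"
    using open_Int_closure_eq_empty[OF open_eval_dist] by blast
  then obtain \<omega> where \<omega>: "\<omega> \<in> extreme_points F" "eval_dist B \<omega> \<sigma> < e / 2"
    by blast
  have "\<omega> \<in> {\<tau>. eval_dist B \<tau> \<omega> < e / 2}" using e by simp
  then obtain A c where A: "c < re (\<omega> A)" "\<forall>\<tau>\<in>F. c \<le> re (\<tau> A) \<longrightarrow> \<tau> \<in> {\<tau>. eval_dist B \<tau> \<omega> < e / 2}"
    by (rule extreme_point_slice[OF FU(2,3,5) \<omega>(1) open_eval_dist])
  have "eval_dist B \<tau> \<sigma> < e" if "\<tau> \<in> F" "c \<le> re (\<tau> A)" for \<tau>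
    using A(2) that \<omega>(2) eval_dist_triangle[of B \<tau> \<sigma> \<omega>] by auto
  moreover have "\<omega> \<in> F" using \<omega>(1) extreme_points_subset by blast
  ultimately show "\<exists>A c. (\<exists>\<tau>\<in>F. c < re (\<tau> A)) \<and> (\<forall>\<tau>\<in>F. c \<le> re (\<tau> A) \<longrightarrow> eval_dist B \<tau> \<sigma> < e)"
    using A(1) by blast
qed

text \<open>The polar is equicontinuous, so evaluation at any point can be replaced by evaluation at
  a term of the dense sequence, with an error uniform over the polar.\<close>

lemma polar_equicontinuous:
  fixes a :: "nat \<Rightarrow> 'a"
  assumes dense: "\<forall>W. open W \<and> W \<noteq> {} \<longrightarrow> (\<exists>n. a n \<in> W)"
    and U: "zero_nhd U" and e: "e > 0"
  obtains k where "\<forall>\<tau>\<in>polar sc U. norm (\<tau> (a k) - \<tau> x) \<le> e"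
proof -
  obtain W where W: "open W" "0 \<in> W" "W \<subseteq> U" using U by (auto simp: zero_nhd_def)
  let ?N = "{y. sc (of_real (1/e)) (y + (-x)) \<in> W}"
  have "continuous_on UNIV (\<lambda>y. sc (of_real (1/e)) (y + (-x)))"
    using continuous_on_compose2[OF continuous_sc_right continuous_translate] by blast
  then have "open ?N"
    using open_vimage[OF W(1)] by (simp add: vimage_def)
  moreover have "x \<in> ?N" using W by simp
  ultimately obtain k where k: "a k \<in> ?N" using dense by blast
  have "norm (\<tau> (a k) - \<tau> x) \<le> e" if "\<tau> \<in> polar sc U" for \<tau>
  proof -
    have "norm (\<tau> (sc (of_real (1/e)) (a k - x))) \<le> 1"
      using k W(3) that by (auto simp: polar_def)
    then have "norm (of_real (1/e) * (\<tau> (a k) - \<tau> x)) \<le> 1"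
      using polar_tdual[OF that] by (simp only: tdual_scale tdual_diff)
    then show ?thesis using e by (simp add: norm_mult norm_divide)
  qed
  then show thesis using that by blast
qed

text \<open>The slice close to \<sigma> contains an extreme point, namely a maximiser of its
  evaluation. Equicontinuity carries the closeness from the dense sequence over to the finitely many
  coordinates of a weak* neighbourhood.\<close>

lemma near_extreme_imp_closure_extreme:
  fixes a :: "nat \<Rightarrow> 'a"
  assumes dense: "\<forall>W. open W \<and> W \<noteq> {} \<longrightarrow> (\<exists>n. a n \<in> W)"
    and U: "zero_nhd U" and F: "F \<in> CU_U sc U"
    and ne: "\<And>m. F \<in> near_extreme (a ` {..<m}) (1 / real (Suc m))"
  shows "F \<subseteq> closure (extreme_points F)"
proof
  fix \<sigma> assume \<sigma>: "\<sigma> \<in> F"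
  note FU = CU_UD[OF U F]
  have "\<exists>\<omega>\<in>extreme_points F. \<omega> \<in> W" if "open W" "\<sigma> \<in> W" for W
  proof -
    obtain I e where I: "finite I" "e > 0" "\<forall>g. (\<forall>i\<in>I. dist (g i) (\<sigma> i) < e) \<longrightarrow> g \<in> W"
      using \<open>open W\<close> \<open>\<sigma> \<in> W\<close> by (rule open_fun_basis)
    have "\<forall>i. \<exists>k. \<forall>\<tau>\<in>polar sc U. norm (\<tau> (a k) - \<tau> i) \<le> e / 4"
      by (intro allI, rule polar_equicontinuous[OF dense U, of "e / 4"]) (use I(2) in auto)
    then obtain k where k: "\<And>i \<tau>. \<tau> \<in> polar sc U \<Longrightarrow> norm (\<tau> (a (k i)) - \<tau> i) \<le> e / 4"
      by metis
    obtain n where n: "1 / real (Suc n) < e / 4" using I(2) nat_approx_posE[of "e / 4"] by auto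
    \<comment> \<open>Large enough that the first \<open>m\<close> terms include every index
      \<open>k i\<close> and the radius is below \<open>e/4\<close>; \<open>insert 0\<close> covers
      an empty \<open>I\<close>.\<close>
    define m where "m = n + Suc (Max (insert 0 (k ` I)))"
    have m: "1 / real (Suc m) < e / 4"
    proof -
      have "1 / real (Suc m) \<le> 1 / real (Suc n)" by (intro divide_left_mono) (auto simp: m_def)
      then show ?thesis using n by linarith
    qed
    have km: "k i < m" if "i \<in> I" for i
    proof -
      have "k i \<le> Max (insert 0 (k ` I))" using I(1) that by (intro Max_ge) auto
      then show ?thesis by (simp add: m_def)
    qed
    obtain A c \<tau>0 where A: "\<tau>0 \<in> F" "c < re (\<tau>0 A)"
      "\<forall>\<tau>\<in>F. c \<le> re (\<tau> A) \<longrightarrow> eval_dist (a ` {..<m}) \<tau> \<sigma> < 1 / real (Suc m)"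
      using ne[of m] \<sigma> unfolding near_extreme_def by blast
    obtain \<omega> where \<omega>: "\<omega> \<in> extreme_points F" "\<And>\<tau>. \<tau> \<in> F \<Longrightarrow> re (\<tau> A) \<le> re (\<omega> A)"
      using extreme_point_maximizer[OF dense U FU(2,3,1,4)] by blast
    have \<omega>F: "\<omega> \<in> F" using \<omega>(1) extreme_points_subset by blast
    then have close: "eval_dist (a ` {..<m}) \<omega> \<sigma> < 1 / real (Suc m)"
      using A(3) \<omega>(2)[OF A(1)] A(2) by auto
    have "dist (\<omega> i) (\<sigma> i) < e" if "i \<in> I" for i
    proof -
      have "norm (\<omega> (a (k i)) - \<sigma> (a (k i))) \<le> eval_dist (a ` {..<m}) \<omega> \<sigma>"
        using km[OF that] by (intro norm_le_eval_dist) auto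
      then have "norm (\<omega> (a (k i)) - \<sigma> (a (k i))) < e / 4" using close m by linarith
      moreover have "norm (\<omega> (a (k i)) - \<omega> i) \<le> e / 4" "norm (\<sigma> (a (k i)) - \<sigma> i) \<le> e / 4"
        using k FU(4) \<omega>F \<sigma> by blast+
      moreover have "norm (\<omega> i - \<sigma> i) \<le> norm (\<omega> (a (k i)) - \<sigma> (a (k i)))
          + (norm (\<omega> (a (k i)) - \<omega> i) + norm (\<sigma> (a (k i)) - \<sigma> i))"
      proof -
        have "\<omega> i - \<sigma> i = (\<omega> (a (k i)) - \<sigma> (a (k i))) + ((\<sigma> (a (k i)) - \<sigma> i) - (\<omega> (a (k i)) - \<omega> i))"
          by simp
        from arg_cong[OF this, of norm] show ?thesis
          using norm_triangle_ineq[of "\<omega> (a (k i)) - \<sigma> (a (k i))" "(\<sigma> (a (k i)) - \<sigma> i) - (\<omega> (a (k i)) - \<omega> i)"]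
            norm_triangle_ineq4[of "\<sigma> (a (k i)) - \<sigma> i" "\<omega> (a (k i)) - \<omega> i"] by linarith
      qed
      ultimately show ?thesis using I(2) unfolding dist_norm by linarith
    qed
    then show ?thesis using I(3) \<omega>(1) by blast
  qed
  from this[of "- closure (extreme_points F)"] show "\<sigma> \<in> closure (extreme_points F)"
    using closure_subset[of "extreme_points F"] by auto
qed

text \<open>The closure of the extreme points always lies in the closed set \<open>F\<close>, so
  only the reverse inclusion is at stake.\<close>

lemma D_U_iff:
  fixes a :: "nat \<Rightarrow> 'a"
  assumes dense: "\<forall>W. open W \<and> W \<noteq> {} \<longrightarrow> (\<exists>n. a n \<in> W)" and U: "zero_nhd U"
  shows "D_U sc U = (\<Inter>m. CU_U sc U \<inter> near_extreme (a ` {..<m}) (1 / real (Suc m)))"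
proof -
  have "F = weakstar sc closure_of extreme_points F
      \<longleftrightarrow> (\<forall>m. F \<in> near_extreme (a ` {..<m}) (1 / real (Suc m)))" if F: "F \<in> CU_U sc U" for F
  proof -
    note FU = CU_UD[OF U F]
    have eq: "weakstar sc closure_of extreme_points F = closure (extreme_points F)"
      by (rule weakstar_closure[OF extreme_points_subset FU(3,5)])
    have "closure (extreme_points F) \<subseteq> F"
      using compact_imp_closed_fun[OF FU(3)] extreme_points_subset by (rule closure_minimal[rotated])
    then have "F = closure (extreme_points F) \<longleftrightarrow> F \<subseteq> closure (extreme_points F)" by blast
    also have "\<dots> \<longleftrightarrow> (\<forall>m. F \<in> near_extreme (a ` {..<m}) (1 / real (Suc m)))"
      using closure_extreme_imp_near_extreme[OF U F] near_extreme_imp_closure_extreme[OF dense U F] by auto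
    finally show ?thesis unfolding eq .
  qed
  then show ?thesis unfolding D_U_def by auto
qed

end

section \<open>Baire category\<close>

text \<open>Dimension count: \<open>Suc (card T)\<close> independent functions cannot lie in the
  span of \<open>T\<close>. Independence is given for an indexed sequence, so injectivity comes
  first, in order to pass to sets of functions.\<close>

lemma independent_family_not_in_span:
  fixes g :: "nat \<Rightarrow> 'a \<Rightarrow> 'k::field"
  assumes ind: "\<forall>n (c::nat \<Rightarrow> 'k). (\<forall>x. (\<Sum>i<n. c i * g i x) = 0) \<longrightarrow> (\<forall>i<n. c i = 0)"
    and T: "finite T"
  shows "\<exists>n. g n \<notin> fvs.span T"
proof (rule ccontr)
  assume "\<nexists>n. g n \<notin> fvs.span T"
  then have sub: "range g \<subseteq> fvs.span T" by blast
  have "i = j" if "g i = g j" "i < j" for i j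
  proof -
    \<comment> \<open>A repeated function would give a relation with coefficients 1 and -1.\<close>
    let ?c = "\<lambda>l. if l = i then 1 else if l = j then - 1 else (0::'k)"
    have "(\<Sum>l<Suc j. ?c l * g l x) = 0" for x
    proof -
      have "(\<Sum>l<Suc j. ?c l * g l x) = (\<Sum>l<j. ?c l * g l x) - g j x" using that(2) by simp
      also have "(\<Sum>l<j. ?c l * g l x) = (\<Sum>l<j. if l = i then g i x else 0)" by (rule sum.cong) auto
      also have "\<dots> = g i x" using that(2) by simp
      finally show ?thesis using that(1) by simp
    qed
    then have "\<forall>l<Suc j. ?c l = 0" using spec[OF spec[OF ind, of "Suc j"], of ?c] by blast
    then have "?c i = 0" using that(2) by (elim allE[of _ i] impE) auto
    then show ?thesis by simp
  qed
  then have inj: "inj g" unfolding inj_def by (metis linorder_neqE_nat)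
  have "card (g ` {..<Suc (card T)}) \<le> card T"
  proof (rule fvs.independent_span_bound[OF T, THEN conjunct2])
    show "g ` {..<Suc (card T)} \<subseteq> fvs.span T" using sub by blast
    show "\<not> fvs.dependent (g ` {..<Suc (card T)})"
    proof
      assume "fvs.dependent (g ` {..<Suc (card T)})"
      then obtain u where u: "\<exists>v\<in>g ` {..<Suc (card T)}. u v \<noteq> 0" "(\<Sum>v\<in>g ` {..<Suc (card T)}. fscale (u v) v) = 0"
        by (subst (asm) fvs.dependent_finite) auto
      have "(\<Sum>i<Suc (card T). fscale (u (g i)) (g i)) = 0"
        using u(2) inj by (subst (asm) sum.reindex) (auto intro: inj_on_subset)
      then have "(\<Sum>i<Suc (card T). u (g i) * g i x) = 0" for x
        using fun_cong[of "\<Sum>i<Suc (card T). fscale (u (g i)) (g i)" 0 x]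
        unfolding sum_fun_apply fscale_def by simp
      then have "\<forall>i<Suc (card T). u (g i) = 0" using spec[OF spec[OF ind, of "Suc (card T)"], of "\<lambda>i. u (g i)"] by blast
      then show False using u(1) by auto
    qed
  qed
  moreover have "card (g ` {..<Suc (card T)}) = Suc (card T)"
    using inj by (subst card_image) (auto intro: inj_on_subset)
  ultimately show False by simp
qed

section \<open>Density by perturbation, and the result for one zero neighbourhood\<close>

context tvs_dual begin

text \<open>Some functional of the sequence lies outside the span. Its bound on \<open>U\<close>
  allows scaling it into the polar, and a nonzero factor keeps it outside the span.\<close>

lemma inf_dim_cond_polar:
  assumes "inf_dim_cond sc U" "finite T"
  shows "\<exists>g\<in>polar sc U. g \<notin> fvs.span T"
proof -
  obtain s B where s: "\<And>n. s n \<in> tdual sc"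
    "\<forall>n (c::nat \<Rightarrow> 'k). (\<forall>x. (\<Sum>i<n. c i * s i x) = 0) \<longrightarrow> (\<forall>i<n. c i = 0)"
    "\<And>n A. A \<in> U \<Longrightarrow> norm (s n A) \<le> B n"
    using assms(1) unfolding inf_dim_cond_def by metis
  obtain n where n: "s n \<notin> fvs.span T" using independent_family_not_in_span[OF s(2) assms(2)] by blast
  define b where "b = 1 + \<bar>B n\<bar>"
  have b: "b > 0" by (simp add: b_def)
  define g where "g = fscale (of_real (1 / b)) (s n)"
  have "s n = fscale (of_real b) g" using b by (auto simp: g_def fscale_def)
  then have "g \<notin> fvs.span T" using n fvs.span_scale by metis
  moreover have "g \<in> polar sc U"
  proof -
    have "continuous_on UNIV g" unfolding g_def fscale_def
      by (intro continuous_on_mult continuous_on_const tdual_cont s(1))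
    then have "g \<in> tdual sc"
      using s(1)[of n] by (simp add: tdual_iff g_def fscale_def add_divide_distrib)
    moreover have "norm (g A) \<le> 1" if "A \<in> U" for A
    proof -
      have "norm (s n A) \<le> b" using s(3)[OF that, of n] unfolding b_def by linarith
      then show ?thesis using b by (simp add: g_def fscale_def norm_mult norm_divide)
    qed
    ultimately show ?thesis by (simp add: polar_def)
  qed
  ultimately show ?thesis by blast
qed

lemma inf_dim_cond_antimono:
  assumes "inf_dim_cond sc U" "V \<subseteq> U"
  shows "inf_dim_cond sc V"
proof -
  obtain s where s: "\<forall>n. s n \<in> tdual sc"
    "\<forall>n (c::nat \<Rightarrow> 'k). (\<forall>x. (\<Sum>i<n. c i * s i x) = 0) \<longrightarrow> (\<forall>i<n. c i = 0)"
    "\<forall>n. \<exists>B::real. \<forall>A\<in>U. norm (s n A) \<le> B"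
    using assms(1) unfolding inf_dim_cond_def by blast
  have "\<forall>n. \<exists>B::real. \<forall>A\<in>V. norm (s n A) \<le> B" using s(3) assms(2) by (meson subsetD)
  then show ?thesis unfolding inf_dim_cond_def using s(1,2) by (intro exI[of _ s]) simp
qed

text \<open>Each point of the net is pushed slightly in a direction outside the span of the set built so
  far, so that joining it keeps the old extreme points and adds a new one.\<close>

lemma perturbed_hull:
  assumes U: "zero_nhd U" and inf: "inf_dim_cond sc U" and F: "F \<in> CU_U sc U"
    and \<delta>: "0 < \<delta>" "\<delta> < 1" "\<And>f g. f \<in> polar sc U \<Longrightarrow> g \<in> polar sc U \<Longrightarrow> \<delta> * eval_dist B f g < \<eta>"
    and X: "finite X" "X \<noteq> {}" "X \<subseteq> F"
  shows "\<exists>G T. finite T \<and> G \<subseteq> fvs.span T \<and> G \<in> CU_U sc U \<and> (\<forall>\<sigma>\<in>G. \<exists>\<tau>\<in>F. eval_dist B \<sigma> \<tau> < \<eta>)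
    \<and> (\<forall>x\<in>X. \<exists>e\<in>extreme_points G. eval_dist B x e < \<eta>)"
  using X
proof (induction X rule: finite_ne_induct)
  case (singleton x)
  note FU = CU_UD[OF U F]
  have "x \<in> F" using singleton by simp
  have \<eta>: "\<eta> > 0" using \<delta>(3)[of x x] \<open>x \<in> F\<close> FU(4) by auto
  have "fconvex {x}" by (rule fconvexI) auto
  then have "{x} \<in> CU_U sc U" using CU_U_iff[OF U] \<open>x \<in> F\<close> FU(4) by auto
  moreover have "x \<in> extreme_points {x}" by (rule extreme_pointsI) auto
  moreover have "{x} \<subseteq> fvs.span {x}" by (rule fvs.span_superset)
  moreover have "eval_dist B x x < \<eta>" using \<eta> by simp
  ultimately show ?case using \<open>x \<in> F\<close> by (intro exI[of _ "{x}"] conjI) blast+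
next
  case (insert x X)
  note FU = CU_UD[OF U F]
  have xF: "x \<in> F" "X \<subseteq> F" using insert.prems by auto
  then obtain G T where G: "finite T" "G \<subseteq> fvs.span T" "G \<in> CU_U sc U"
    "\<And>\<sigma>. \<sigma> \<in> G \<Longrightarrow> \<exists>\<tau>\<in>F. eval_dist B \<sigma> \<tau> < \<eta>" "\<And>x. x \<in> X \<Longrightarrow> \<exists>e\<in>extreme_points G. eval_dist B x e < \<eta>"
    using insert.IH by auto
  note GU = CU_UD[OF U G(3)]
  \<comment> \<open>The span includes \<open>x\<close> because \<open>h\<close> will be a
    combination of \<open>g\<close> and \<open>x\<close>.\<close>
  obtain g where g: "g \<in> polar sc U" "g \<notin> fvs.span (insert x T)"
    using inf_dim_cond_polar[OF inf, of "insert x T"] G(1) by auto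
  define h where "h = cmb \<delta> g x"
  have hP: "h \<in> polar sc U" unfolding h_def using g(1) xF FU(4) \<delta> by (intro fconvexD[OF fconvex_polar]) auto
  have hT: "h \<notin> fvs.span T"
  proof
    assume "h \<in> fvs.span T"
    then have "h \<in> fvs.span (insert x T)" using fvs.span_mono[of T "insert x T"] by blast
    moreover have "x \<in> fvs.span (insert x T)" by (simp add: fvs.span_base)
    \<comment> \<open>Solving \<open>h = cmb \<delta> g x\<close> for \<open>g\<close> puts
      \<open>g\<close> into the span, a contradiction.\<close>
    ultimately have "fscale (of_real (1 / \<delta>)) (h - fscale (of_real (1 - \<delta>)) x) \<in> fvs.span (insert x T)"
      by (intro fvs.span_scale fvs.span_diff)
    moreover have "fscale (of_real (1 / \<delta>)) (h - fscale (of_real (1 - \<delta>)) x) = g"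
      using \<delta>(1) by (auto simp: h_def cmb_def fscale_def)
    ultimately show False using g(2) by simp
  qed
  have hx: "eval_dist B h x < \<eta>"
  proof -
    have "eval_dist B h x = \<delta> * eval_dist B g x"
      unfolding eval_dist_def sum_distrib_left
    proof (rule sum.cong)
      fix b
      have "h b - x b = of_real \<delta> * (g b - x b)" by (simp add: h_def cmb_def algebra_simps)
      then show "norm (h b - x b) = \<delta> * norm (g b - x b)" using \<delta>(1) by (simp add: norm_mult)
    qed simp
    then show ?thesis using \<delta>(3)[OF g(1), of x] xF(1) FU(4) by auto
  qed
  let ?G = "join G {h}" and ?T = "insert h T"
  have "fconvex {h}" by (rule fconvexI) auto
  then have "?G \<in> CU_U sc U"
    unfolding CU_U_iff[OF U]
    using fconvex_join[OF GU(2)] compact_join[OF GU(3), of "{h}"] join_subset[OF fconvex_polar GU(4), of "{h}"] hP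
      join_superset1[of "{h}" G] GU(1) by auto
  moreover have "?G \<subseteq> fvs.span ?T"
  proof
    fix \<sigma> assume "\<sigma> \<in> ?G"
    then obtain t f where t: "\<sigma> = cmb t f h" "f \<in> G" unfolding join_def by blast
    have "f \<in> fvs.span ?T" using t(2) G(2) fvs.span_mono[of T ?T] by blast
    moreover have "h \<in> fvs.span ?T" by (simp add: fvs.span_base)
    ultimately show "\<sigma> \<in> fvs.span ?T" unfolding t(1) by (rule cmb_in_span)
  qed
  moreover have "\<exists>\<tau>\<in>F. eval_dist B \<sigma> \<tau> < \<eta>" if \<sigma>: "\<sigma> \<in> ?G" for \<sigma>
  proof -
    obtain t f where t: "\<sigma> = cmb t f h" "f \<in> G" "0 \<le> t" "t \<le> 1" using \<sigma> unfolding join_def by blast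
    obtain \<tau> where \<tau>: "\<tau> \<in> F" "eval_dist B f \<tau> < \<eta>" using G(4)[OF t(2)] by blast
    \<comment> \<open>The same combination of \<tau> and \<open>x\<close> lies in \<open>F\<close>
      by convexity and is close to \<sigma>.\<close>
    show ?thesis
      using eval_dist_cmb_less[OF \<tau>(2) hx t(3,4)] fconvexD[OF FU(2) \<tau>(1) xF(1) t(3,4)] t(1) by blast
  qed
  moreover have "\<exists>e\<in>extreme_points ?G. eval_dist B y e < \<eta>" if y: "y \<in> insert x X" for y
  proof (cases "y = x")
    case True
    then show ?thesis using extreme_points_join_right[OF G(2) GU(1) hT] hx eval_dist_commute[of B h x] by auto
  next
    case False
    then obtain e where "e \<in> extreme_points G" "eval_dist B y e < \<eta>" using G(5) y by blast
    then show ?thesis using extreme_points_join_left[OF G(2) hT] by blast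
  qed
  ultimately show ?case using G(1) by (intro exI[of _ ?G] exI[of _ ?T]) auto
qed

text \<open>\<open>perturbed_hull\<close> turns a finite net of \<open>F\<close> into extreme points
  of a set \<open>G\<close> close to \<open>F\<close>. Every point of \<open>G\<close> then has an
  extreme point of \<open>G\<close> nearby, and a small slice at that extreme point is the one
  required.\<close>

lemma near_extreme_approximation:
  assumes U: "zero_nhd U" and inf: "inf_dim_cond sc U" and F: "F \<in> CU_U sc U"
    and fin: "finite As" "finite B" and pos: "(\<epsilon>::real) > 0" "e > 0"
  shows "\<exists>G \<in> CU_U sc U \<inter> near_extreme B e. \<forall>A\<in>As. dH A F G < ereal \<epsilon>"
proof -
  note FU = CU_UD[OF U F]
  \<comment> \<open>One pseudometric serves both goals: its terms over \<open>As\<close> bound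
    \<open>dH\<close>, those over \<open>B\<close> give \<open>near_extreme\<close>.\<close>
  let ?B = "As \<union> B"
  have finB: "finite ?B" using fin by simp
  \<comment> \<open>Points of \<open>F\<close> have extreme points of \<open>G\<close> within
    \<open>2 * \<eta>\<close>, to be below \<epsilon>. The chain from a slice through its extreme
    point and \<open>F\<close> back to \<open>G\<close> costs
    \<open>\<eta> + 2 * \<eta> + \<eta>\<close>, to be at most \<open>e\<close>.\<close>
  define \<eta> where "\<eta> = min (\<epsilon> / 3) (e / 4)"
  have \<eta>: "\<eta> > 0" "2 * \<eta> < \<epsilon>" "4 * \<eta> \<le> e" using pos by (auto simp: \<eta>_def min_def)
  have "\<forall>b. \<exists>M\<ge>0. \<forall>\<sigma>\<in>polar sc U. norm (\<sigma> b) \<le> M"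
    by (intro allI, rule polar_bounded[OF U]) blast
  then obtain M where M: "\<And>b. M b \<ge> 0" "\<And>b \<sigma>. \<sigma> \<in> polar sc U \<Longrightarrow> norm (\<sigma> b) \<le> M b"
    by metis
  define Q where "Q = (\<Sum>b\<in>?B. 2 * M b)"
  have Q: "Q \<ge> 0" using M(1) by (simp add: Q_def sum_nonneg)
  have QB: "eval_dist ?B f g \<le> Q" if "f \<in> polar sc U" "g \<in> polar sc U" for f g
    unfolding eval_dist_def Q_def
  proof (rule sum_mono)
    fix b
    show "norm (f b - g b) \<le> 2 * M b"
      using norm_triangle_ineq4[of "f b" "g b"] M(2)[OF that(1), of b] M(2)[OF that(2), of b] by linarith
  qed
  \<comment> \<open>\<open>Q\<close> bounds the diameter of the polar, so mixing in any of its
    functionals with weight \<delta> moves a point by less than \<eta>.\<close>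
  define \<delta> where "\<delta> = min (1/2) (\<eta> / (Q + 1))"
  have \<delta>: "0 < \<delta>" "\<delta> < 1" using \<eta> Q by (auto simp: \<delta>_def)
  have \<delta>Q: "\<delta> * eval_dist ?B f g < \<eta>" if "f \<in> polar sc U" "g \<in> polar sc U" for f g
  proof -
    have "\<delta> * eval_dist ?B f g \<le> \<eta> / (Q + 1) * Q"
      using QB[OF that] \<delta> Q \<eta>(1) by (intro mult_mono) (auto simp: \<delta>_def eval_dist_def sum_nonneg)
    also have "\<dots> < \<eta>" using Q \<eta>(1) by (simp add: field_simps)
    finally show ?thesis .
  qed
  obtain X where X: "X \<subseteq> F" "finite X" "F \<subseteq> (\<Union>x\<in>X. {\<tau>. eval_dist ?B \<tau> x < \<eta>})"
  proof (rule compactE_image[OF FU(3), of F "\<lambda>x. {\<tau>. eval_dist ?B \<tau> x < \<eta>}"])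
    show "F \<subseteq> (\<Union>x\<in>F. {\<tau>. eval_dist ?B \<tau> x < \<eta>})" using \<eta>(1) by force
  qed (auto intro: open_eval_dist)
  have "X \<noteq> {}" using X(3) FU(1) by auto
  then have "\<exists>G T. finite T \<and> G \<subseteq> fvs.span T \<and> G \<in> CU_U sc U \<and> (\<forall>\<sigma>\<in>G. \<exists>\<tau>\<in>F. eval_dist ?B \<sigma> \<tau> < \<eta>)
      \<and> (\<forall>x\<in>X. \<exists>e\<in>extreme_points G. eval_dist ?B x e < \<eta>)"
    using X \<delta>Q by (intro perturbed_hull[OF U inf F \<delta>]) auto
  then obtain G where G: "G \<in> CU_U sc U" "\<forall>\<sigma>\<in>G. \<exists>\<tau>\<in>F. eval_dist ?B \<sigma> \<tau> < \<eta>"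
    "\<forall>x\<in>X. \<exists>e\<in>extreme_points G. eval_dist ?B x e < \<eta>" by blast
  note GU = CU_UD[OF U G(1)]
  have net: "\<exists>\<omega>\<in>extreme_points G. eval_dist ?B \<sigma> \<omega> < 2 * \<eta>" if \<sigma>: "\<sigma> \<in> F" for \<sigma>
  proof -
    obtain x where x: "x \<in> X" "eval_dist ?B \<sigma> x < \<eta>" using X(3) \<sigma> by blast
    obtain \<omega> where \<omega>: "\<omega> \<in> extreme_points G" "eval_dist ?B x \<omega> < \<eta>" using G(3) x(1) by blast
    then show ?thesis using eval_dist_triangle[of ?B \<sigma> \<omega> x] x(2) by (intro bexI[of _ \<omega>]) auto
  qed
  have "dH A F G < ereal \<epsilon>" if "A \<in> As" for A
  proof -
    have A: "A \<in> ?B" using that by simp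
    have "dH A F G \<le> ereal (2 * \<eta>)"
    proof (rule dH_leI)
      fix \<sigma> assume "\<sigma> \<in> F"
      then obtain \<omega> where "\<omega> \<in> extreme_points G" "eval_dist ?B \<sigma> \<omega> < 2 * \<eta>" using net by blast
      then show "\<exists>\<tau>\<in>G. norm (\<sigma> A - \<tau> A) \<le> 2 * \<eta>"
        using norm_le_eval_dist[OF finB A, of \<sigma> \<omega>] extreme_points_subset[of G]
        by (intro bexI[of _ \<omega>]) auto
    next
      fix \<tau> assume "\<tau> \<in> G"
      then obtain \<sigma> where "\<sigma> \<in> F" "eval_dist ?B \<tau> \<sigma> < \<eta>" using G(2) by blast
      then show "\<exists>\<sigma>\<in>F. norm (\<sigma> A - \<tau> A) \<le> 2 * \<eta>"
        using norm_le_eval_dist[OF finB A, of \<tau> \<sigma>] \<eta>(1) norm_minus_commute[of "\<sigma> A" "\<tau> A"]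
        by (intro bexI[of _ \<sigma>]) auto
    qed
    also have "\<dots> < ereal \<epsilon>" using \<eta>(2) by simp
    finally show ?thesis .
  qed
  moreover have "G \<in> near_extreme B e"
    unfolding near_extreme_def
  proof (intro CollectI ballI)
    fix \<sigma> assume "\<sigma> \<in> G"
    then obtain \<tau> where \<tau>: "\<tau> \<in> F" "eval_dist ?B \<sigma> \<tau> < \<eta>" using G(2) by blast
    obtain \<omega> where \<omega>: "\<omega> \<in> extreme_points G" "eval_dist ?B \<tau> \<omega> < 2 * \<eta>" using net[OF \<tau>(1)] by blast
    have "\<omega> \<in> {\<kappa>. eval_dist ?B \<kappa> \<omega> < \<eta>}" using \<eta>(1) by simp
    then obtain A c where A: "c < re (\<omega> A)"
      "\<forall>\<kappa>\<in>G. c \<le> re (\<kappa> A) \<longrightarrow> \<kappa> \<in> {\<kappa>. eval_dist ?B \<kappa> \<omega> < \<eta>}"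
      by (rule extreme_point_slice[OF GU(2,3,5) \<omega>(1) open_eval_dist])
    have "eval_dist B \<kappa> \<sigma> < e" if "\<kappa> \<in> G" "c \<le> re (\<kappa> A)" for \<kappa>
    proof -
      have "eval_dist B \<kappa> \<sigma> \<le> eval_dist ?B \<kappa> \<sigma>" by (rule eval_dist_mono[OF finB]) simp
      also have "\<dots> \<le> eval_dist ?B \<kappa> \<omega> + (eval_dist ?B \<omega> \<tau> + eval_dist ?B \<tau> \<sigma>)"
        using eval_dist_triangle[of ?B \<kappa> \<sigma> \<omega>] eval_dist_triangle[of ?B \<omega> \<sigma> \<tau>] by linarith
      also have "\<dots> < 4 * \<eta>"
        using A(2)[rule_format, OF that] \<omega>(2) \<tau>(2) eval_dist_commute[of ?B \<tau> \<sigma>] eval_dist_commute[of ?B \<tau> \<omega>] by simp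
      finally show ?thesis using \<eta>(3) by linarith
    qed
    moreover have "\<omega> \<in> G" using \<omega>(1) extreme_points_subset by blast
    ultimately show "\<exists>A c. (\<exists>\<tau>\<in>G. c < re (\<tau> A)) \<and> (\<forall>\<tau>\<in>G. c \<le> re (\<tau> A) \<longrightarrow> eval_dist B \<tau> \<sigma> < e)"
      using A(1) by blast
  qed
  ultimately show ?thesis using G(1) by blast
qed

lemma dense_near_extreme:
  assumes "zero_nhd U" "inf_dim_cond sc U" "finite B" "e > 0"
  shows "subtopology wsH (CU_U sc U) closure_of (CU_U sc U \<inter> near_extreme B e) = CU_U sc U"
proof -
  let ?T = "subtopology wsH (CU_U sc U)"
  have "(CU_U sc U \<inter> near_extreme B e) \<inter> V \<noteq> {}" if V: "openin ?T V" "V \<noteq> {}" for V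
  proof -
    obtain W where W: "openin wsH W" "V = W \<inter> CU_U sc U" using V(1) by (auto simp: openin_subtopology)
    obtain F where F: "F \<in> W" "F \<in> CU_U sc U" using V(2) W(2) by blast
    obtain As \<epsilon> where As: "finite As" "0 < (\<epsilon>::real)" "{G. \<forall>A\<in>As. dH A F G < ereal \<epsilon>} \<subseteq> W"
      using W(1) F(1) unfolding openin_wsH by blast
    obtain G where "G \<in> CU_U sc U \<inter> near_extreme B e" "\<forall>A\<in>As. dH A F G < ereal \<epsilon>"
      using near_extreme_approximation[OF assms(1,2) F(2) As(1) assms(3) As(2) assms(4)] by blast
    then show ?thesis using As(3) W(2) by blast
  qed
  then have "?T closure_of (CU_U sc U \<inter> near_extreme B e) = topspace ?T"
    unfolding dense_intersects_open by blast
  then show ?thesis by simp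
qed

lemma dense_gdelta_D_U:
  fixes a :: "nat \<Rightarrow> 'a"
  assumes dense: "\<forall>W. open W \<and> W \<noteq> {} \<longrightarrow> (\<exists>n. a n \<in> W)"
    and U: "zero_nhd U" and inf: "inf_dim_cond sc U"
  shows "dense_gdelta_in (subtopology wsH (CU_U sc U)) (D_U sc U)"
proof -
  let ?T = "subtopology wsH (CU_U sc U)"
  let ?O = "range (\<lambda>m. CU_U sc U \<inter> near_extreme (a ` {..<m}) (1 / real (Suc m)))"
  have top: "topspace ?T = CU_U sc U" by simp
  have eq: "D_U sc U = \<Inter> ?O" by (rule D_U_iff[OF dense U])
  have op: "openin ?T S" if "S \<in> ?O" for S
    using that openin_near_extreme[OF U] by blast
  have "?T closure_of \<Inter> ?O = topspace ?T"
  proof (rule Baire_category)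
    \<comment> \<open>The alternative that holds is the second: compact Hausdorff spaces are locally
      compact and regular.\<close>
    show "completely_metrizable_space ?T \<or> locally_compact_space ?T \<and> regular_space ?T"
      using compact_space_CU_U[OF U] Hausdorff_CU_U[OF U]
        compact_imp_locally_compact_space compact_Hausdorff_imp_regular_space by blast
    fix S assume S: "S \<in> ?O"
    have "?T closure_of S = CU_U sc U" using S dense_near_extreme[OF U inf] by auto
    then show "openin ?T S \<and> ?T closure_of S = topspace ?T" using op[OF S] by simp
  qed simp
  moreover have "gdelta_in ?T (\<Inter> ?O)"
    unfolding gdelta_in_alt
  proof
    show "\<Inter> ?O \<subseteq> topspace ?T" by auto
    have "(countable intersection_of (openin ?T)) S" if "S \<in> ?O" for S
      using op[OF that] by (rule countable_intersection_of_inc)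
    then show "(countable intersection_of (openin ?T)) (\<Inter> ?O)"
      by (intro countable_intersection_of_Inter) auto
  qed
  ultimately show ?thesis
    unfolding dense_gdelta_in_def eq by auto
qed

section \<open>Passage to the union over all zero neighbourhoods\<close>

lemma polar_antimono: "V \<subseteq> U \<Longrightarrow> polar sc U \<subseteq> polar sc V"
  by (auto simp: polar_def)

lemma CU_U_antimono: "V \<subseteq> U \<Longrightarrow> CU_U sc U \<subseteq> CU_U sc V"
  using polar_antimono unfolding CU_U_def by blast

lemma CU_U_subset_CU: "zero_nhd U \<Longrightarrow> CU_U sc U \<subseteq> CU sc"
  unfolding CU_def by blast

text \<open>A set of \<open>CU sc\<close> outside \<open>CU_U sc U\<close> contains some \<sigma> of
  modulus above 1 at a point \<open>A\<close> of \<open>U\<close>. A suitable multiple of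
  \<open>A\<close> defines an open half-space that this set meets and that is disjoint from the
  polar.\<close>

lemma closedin_CU_U:
  assumes U: "zero_nhd U"
  shows "closedin (subtopology wsH (CU sc)) (CU_U sc U)"
proof -
  let ?T = "subtopology wsH (CU sc)"
  have "openin ?T (CU sc - CU_U sc U)"
  proof (subst openin_subopen, intro ballI)
    fix F assume F: "F \<in> CU sc - CU_U sc U"
    then obtain V where V: "zero_nhd V" "F \<in> CU_U sc V" unfolding CU_def by blast
    note FV = CU_UD[OF V]
    have "\<not> F \<subseteq> polar sc U" using F V FV CU_U_iff[OF U] by blast
    then obtain \<sigma> A where \<sigma>: "\<sigma> \<in> F" "A \<in> U" "norm (\<sigma> A) > 1"
      using FV(5) unfolding polar_def by fastforce
    define z where "z = \<sigma> A"
    have ev: "re (\<tau> (sc (cj z) A)) = z \<bullet> \<tau> A" if "\<tau> \<in> tdual sc" for \<tau>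
      using that inner_cj[of z "\<tau> A"] by (simp add: tdual_scale)
    \<comment> \<open>For the multiple \<open>cj z\<close> the right threshold is
      \<open>norm z\<close>: the value at \<sigma> is its square, which is larger, whereas
      functionals of the polar reach at most \<open>norm z\<close>.\<close>
    let ?N = "CU sc \<inter> {G. \<exists>\<tau>\<in>G. norm z < re (\<tau> (sc (cj z) A))}"
    have "openin ?T ?N" by (rule openin_subtopology_Int2[OF openin_wsH_hit])
    moreover have "F \<in> ?N"
    proof -
      have "norm z * 1 < norm z * norm z" using \<sigma>(3) by (intro mult_strict_left_mono) (auto simp: z_def)
      also have "\<dots> = z \<bullet> \<sigma> A" unfolding z_def by (simp add: norm_eq_sqrt_inner)
      finally show ?thesis using F \<sigma>(1) FV(5) ev[of \<sigma>]
        by (intro IntI CollectI bexI[of _ \<sigma>]) auto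
    qed
    moreover have "?N \<subseteq> CU sc - CU_U sc U"
    proof
      fix G assume G: "G \<in> ?N"
      then obtain \<tau> where \<tau>: "\<tau> \<in> G" "norm z < re (\<tau> (sc (cj z) A))" by blast
      have "\<not> G \<subseteq> polar sc U"
      proof
        assume "G \<subseteq> polar sc U"
        then have \<tau>P: "\<tau> \<in> polar sc U" using \<tau>(1) by blast
        have "re (\<tau> (sc (cj z) A)) \<le> norm z * norm (\<tau> A)"
          unfolding ev[OF polar_tdual[OF \<tau>P]] by (rule norm_cauchy_schwarz)
        also have "\<dots> \<le> norm z * 1" using \<tau>P \<sigma>(2) by (intro mult_left_mono) (auto simp: polar_def)
        finally show False using \<tau>(2) by simp
      qed
      then show "G \<in> CU sc - CU_U sc U" using G CU_UD(4)[OF U] by blast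
    qed
    ultimately show "\<exists>S. openin ?T S \<and> F \<in> S \<and> S \<subseteq> CU sc - CU_U sc U" by blast
  qed
  then show ?thesis using CU_U_subset_CU[OF U] by (simp add: closedin_def)
qed

text \<open>The condition that singles out \<open>D_U sc U\<close> within \<open>CU_U sc U\<close>
  depends on the set alone and not on \<open>U\<close>.\<close>

lemma D_Int_CU_U: "zero_nhd U \<Longrightarrow> D sc \<inter> CU_U sc U = D_U sc U"
  unfolding D_def D_U_def by blast

lemma D_subset_CU: "D sc \<subseteq> CU sc"
  unfolding D_def D_U_def CU_def by blast

lemma gdelta_D:
  fixes a :: "nat \<Rightarrow> 'a"
  assumes dense: "\<forall>W. open W \<and> W \<noteq> {} \<longrightarrow> (\<exists>n. a n \<in> W)"
    and fc: "first_countable (euclidean :: 'a topology)"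
  shows "gdelta_in (subtopology wsH (CU sc)) (D sc)"
proof -
  let ?T = "subtopology wsH (CU sc)"
  obtain Bs where Bs: "countable Bs" "\<And>V. V \<in> Bs \<Longrightarrow> open V"
    "\<And>W. open W \<Longrightarrow> (0::'a) \<in> W \<Longrightarrow> \<exists>V\<in>Bs. 0 \<in> V \<and> V \<subseteq> W"
    using fc unfolding first_countable_def by (metis UNIV_I open_openin topspace_euclidean)
  \<comment> \<open>A countable base at 0. Smaller neighbourhoods have larger polars, so the sets
    \<open>CU_U sc V\<close> with \<open>V\<close> in \<open>Cs\<close> exhaust
    \<open>CU sc\<close>.\<close>
  define Cs where "Cs = {V\<in>Bs. 0 \<in> V}"
  have Cs: "countable Cs" "\<And>V. V \<in> Cs \<Longrightarrow> zero_nhd V"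
    using Bs(1,2) by (auto simp: Cs_def zero_nhd_def)
  let ?P = "\<lambda>V m. CU_U sc V - near_extreme (a ` {..<m}) (1 / real (Suc m))"
  let ?S = "(\<lambda>(V, m). CU sc - ?P V m) ` (Cs \<times> UNIV)"
  have op: "openin ?T S" if S: "S \<in> ?S" for S
  proof -
    obtain V m where V: "V \<in> Cs" "S = CU sc - ?P V m" using S by auto
    have sub: "subtopology ?T (CU_U sc V) = subtopology wsH (CU_U sc V)"
      using CU_U_subset_CU[OF Cs(2)[OF V(1)]] by (simp add: subtopology_subtopology Int_absorb1)
    have "closedin (subtopology wsH (CU_U sc V)) (CU_U sc V - (CU_U sc V \<inter> near_extreme (a ` {..<m}) (1 / real (Suc m))))"
      using openin_near_extreme[OF Cs(2)[OF V(1)]] by (metis closedin_diff closedin_topspace inf_top.left_neutral topspace_subtopology topspace_wsH)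
    then have "closedin (subtopology ?T (CU_U sc V)) (?P V m)" unfolding sub by (simp add: Diff_Int)
    \<comment> \<open>Closedness relative to \<open>CU_U sc V\<close> passes to
      \<open>CU sc\<close>, as \<open>CU_U sc V\<close> is itself closed there.\<close>
    then have "closedin ?T (?P V m)" using closedin_CU_U[OF Cs(2)[OF V(1)]] by (rule closedin_trans_full)
    then show ?thesis unfolding V(2) by (simp add: closedin_def)
  qed
  have ex: "\<exists>V\<in>Cs. F \<in> CU_U sc V" if F: "F \<in> CU sc" for F
  proof -
    obtain U W where U: "F \<in> CU_U sc U" "open W" "0 \<in> W" "W \<subseteq> U"
      using F unfolding CU_def zero_nhd_def by blast
    obtain V where V: "V \<in> Bs" "0 \<in> V" "V \<subseteq> W" using Bs(3)[OF U(2,3)] by blast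
    then have "F \<in> CU_U sc V" using CU_U_antimono[of V U] U by blast
    then show ?thesis using V by (auto simp: Cs_def)
  qed
  \<comment> \<open>The intersection of an empty family would be everything; one index already
    forces membership in \<open>CU sc\<close>.\<close>
  have "Cs \<noteq> {}" using Bs(3)[of UNIV] by (auto simp: Cs_def)
  have "D sc = \<Inter> ?S"
  proof (intro equalityI subsetI InterI)
    fix F S assume F: "F \<in> D sc" and "S \<in> ?S"
    then obtain V m where V: "V \<in> Cs" "S = CU sc - ?P V m" by auto
    have "F \<in> near_extreme (a ` {..<m}) (1 / real (Suc m))" if "F \<in> CU_U sc V"
    proof -
      have "F \<in> D_U sc V" using F that D_Int_CU_U[OF Cs(2)[OF V(1)]] by blast
      then show ?thesis unfolding D_U_iff[OF dense Cs(2)[OF V(1)]] by blast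
    qed
    then show "F \<in> S" using F D_subset_CU V(2) by blast
  next
    fix F assume F: "F \<in> \<Inter> ?S"
    then have FC: "F \<in> CU sc" using \<open>Cs \<noteq> {}\<close> by auto
    obtain V where V: "V \<in> Cs" "F \<in> CU_U sc V" using ex[OF FC] by blast
    have "F \<in> near_extreme (a ` {..<m}) (1 / real (Suc m))" for m
    proof -
      have "CU sc - ?P V m \<in> ?S" using V(1) by auto
      then have "F \<in> CU sc - ?P V m" using F by blast
      then show ?thesis using V(2) by blast
    qed
    then have "F \<in> D_U sc V" unfolding D_U_iff[OF dense Cs(2)[OF V(1)]] using V(2) by blast
    then show "F \<in> D sc" using Cs(2)[OF V(1)] unfolding D_def by blast
  qed
  moreover have "(countable intersection_of (openin ?T)) (\<Inter> ?S)"
  proof (rule countable_intersection_of_Inter)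
    show "countable ?S" using Cs(1) by (intro countable_image countable_SIGMA) auto
    fix S assume "S \<in> ?S"
    then show "(countable intersection_of (openin ?T)) S" by (intro countable_intersection_of_inc op)
  qed
  ultimately show ?thesis unfolding gdelta_in_alt using D_subset_CU by simp
qed

lemma dense_gdelta_D:
  fixes a :: "nat \<Rightarrow> 'a"
  assumes dense: "\<forall>W. open W \<and> W \<noteq> {} \<longrightarrow> (\<exists>n. a n \<in> W)"
    and fc: "first_countable (euclidean :: 'a topology)"
    and U0: "zero_nhd U0" "inf_dim_cond sc U0"
  shows "dense_gdelta_in (subtopology wsH (CU sc)) (D sc)"
proof -
  let ?T = "subtopology wsH (CU sc)"
  have "D sc \<inter> V \<noteq> {}" if V: "openin ?T V" "V \<noteq> {}" for V
  proof -
    obtain W where W: "openin wsH W" "V = W \<inter> CU sc" using V(1) by (auto simp: openin_subtopology)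
    obtain F U where F: "F \<in> W" "F \<in> CU_U sc U" "zero_nhd U" using V(2) W(2) unfolding CU_def by blast
    \<comment> \<open>Shrinking the neighbourhood enlarges the polar, so \<open>F\<close> is kept,
      and the infinite-dimensionality condition is inherited from \<open>U0\<close>. The result for
      one neighbourhood then applies at \<open>F\<close>.\<close>
    define U' where "U' = U \<inter> U0"
    have U': "zero_nhd U'"
      using F(3) U0(1) unfolding zero_nhd_def U'_def by (metis IntI Int_mono open_Int)
    have inf: "inf_dim_cond sc U'"
      by (rule inf_dim_cond_antimono[OF U0(2)]) (simp add: U'_def)
    let ?T' = "subtopology wsH (CU_U sc U')"
    have "F \<in> CU_U sc U'" using F(2) CU_U_antimono[of U' U] by (auto simp: U'_def)
    moreover have "openin ?T' (W \<inter> CU_U sc U')" using W(1) by (auto simp: openin_subtopology)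
    moreover have "?T' closure_of D_U sc U' = topspace ?T'"
      using dense_gdelta_D_U[OF dense U' inf] by (simp add: dense_gdelta_in_def)
    ultimately have "D_U sc U' \<inter> (W \<inter> CU_U sc U') \<noteq> {}"
      using F(1) unfolding dense_intersects_open by blast
    moreover have "D_U sc U' \<subseteq> D sc" using U' unfolding D_def by blast
    ultimately show ?thesis using W(2) CU_U_subset_CU[OF U'] by blast
  qed
  then have "?T closure_of D sc = topspace ?T" unfolding dense_intersects_open by blast
  then show ?thesis unfolding dense_gdelta_in_def using gdelta_D[OF dense fc] D_subset_CU by auto
qed

theorem dense_gdelta:
  assumes "separable_space (euclidean :: 'a topology)"
  shows "zero_nhd U \<Longrightarrow> inf_dim_cond sc U \<Longrightarrow> dense_gdelta_in (subtopology wsH (CU_U sc U)) (D_U sc U)"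
    and "completely_metrizable_space (euclidean :: 'a topology) \<Longrightarrow> zero_nhd U \<Longrightarrow> inf_dim_cond sc U
      \<Longrightarrow> dense_gdelta_in (subtopology wsH (CU sc)) (D sc)"
proof -
  obtain C where C: "countable C" "closure C = (UNIV :: 'a set)"
    using assms unfolding separable_space_def by auto
  then have "C \<noteq> {}" by auto
  have dense: "\<forall>W. open W \<and> W \<noteq> {} \<longrightarrow> (\<exists>n. from_nat_into C n \<in> W)"
  proof (intro allI impI)
    fix W :: "'a set" assume W: "open W \<and> W \<noteq> {}"
    then have "W \<inter> C \<noteq> {}" using open_Int_closure_eq_empty[of W C] C(2) by simp
    then obtain x where "x \<in> W" "x \<in> C" by blast
    then show "\<exists>n. from_nat_into C n \<in> W" using from_nat_into_surj[OF C(1)] by metis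
  qed
  show "zero_nhd U \<Longrightarrow> inf_dim_cond sc U \<Longrightarrow> dense_gdelta_in (subtopology wsH (CU_U sc U)) (D_U sc U)"
    by (rule dense_gdelta_D_U[OF dense])
  show "completely_metrizable_space (euclidean :: 'a topology) \<Longrightarrow> zero_nhd U \<Longrightarrow> inf_dim_cond sc U
      \<Longrightarrow> dense_gdelta_in (subtopology wsH (CU sc)) (D sc)"
    by (rule dense_gdelta_D[OF dense])
      (auto intro: metrizable_imp_first_countable completely_metrizable_imp_metrizable_space)
qed

end

section \<open>The real and the complex instances\<close>

lemma tvs_dual_real: "tvs sc \<Longrightarrow> tvs_dual (sc :: real \<Rightarrow> 'a::{t2_space,ab_group_add} \<Rightarrow> 'a) (\<lambda>c. c)"
  by unfold_locales auto

lemma tvs_dual_complex: "tvs sc \<Longrightarrow> tvs_dual (sc :: complex \<Rightarrow> 'a::{t2_space,ab_group_add} \<Rightarrow> 'a) cnj"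
  by unfold_locales (auto simp: inner_complex_def)

theorem theorem4p12:
  fixes sR :: "real \<Rightarrow> 'a::{t2_space,ab_group_add} \<Rightarrow> 'a"
    and sC :: "complex \<Rightarrow> 'b::{t2_space,ab_group_add} \<Rightarrow> 'b"
  shows
   "(tvs sR \<and> dual_separates_points sR \<longrightarrow>
      (\<forall>U. gateaux_space sR \<and> separable_space (euclidean::'a topology) \<and> zero_nhd U
              \<and> inf_dim_cond sR U
           \<longrightarrow> dense_gdelta_in (subtopology wsH (CU_U sR U)) (D_U sR U))
    \<and> (separable_space (euclidean::'a topology) \<and> completely_metrizable_space (euclidean::'a topology)
         \<and> (\<exists>U. zero_nhd U \<and> inf_dim_cond sR U)
           \<longrightarrow> dense_gdelta_in (subtopology wsH (CU sR)) (D sR)))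
  \<and> (tvs sC \<and> dual_separates_points sC \<longrightarrow>
      (\<forall>U. gateaux_space sC \<and> separable_space (euclidean::'b topology) \<and> zero_nhd U
              \<and> inf_dim_cond sC U
           \<longrightarrow> dense_gdelta_in (subtopology wsH (CU_U sC U)) (D_U sC U))
    \<and> (separable_space (euclidean::'b topology) \<and> completely_metrizable_space (euclidean::'b topology)
         \<and> (\<exists>U. zero_nhd U \<and> inf_dim_cond sC U)
           \<longrightarrow> dense_gdelta_in (subtopology wsH (CU sC)) (D sC)))"
  using tvs_dual.dense_gdelta[OF tvs_dual_real, of sR] tvs_dual.dense_gdelta[OF tvs_dual_complex, of sC]
  by blast

end
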